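(* For every integer $v>1$ for which a $(K_v,P_4)$-design exists, \[\mathcal{L}_1P_4(v)=\{n\geq v-1\mid n\equiv 0,1\pmod 4\},\] \[\mathcal{L}_2P_4(v)\subseteq\{n\geq v\mid n\equiv 0,1\pmod 4\}.\]
   Context: All graphs are finite and simple; $\Gamma\leq K$ means $\Gamma$ is a subgraph of $K$ (or is isomorphic to one, when $\Gamma$ is an abstract graph). $P_k$ is the path on $k$ vertices. For a graph $K$ and $\Gamma\leq K$, a $(K,\Gamma)$-design is a set $\mathcal{B}$ of subgraphs of $K$, called blocks, each isomorphic to $\Gamma$, whose edge-sets partition $E(K)$. $K_n$ is the complete graph on a set of $n$ vertices (any $n$-element vertex set may be used); a $\Gamma$-design of order $n$ is a $(K_n,\Gamma)$-design. Given $\Gamma'\leq\Gamma$, a $(K,\Gamma)$-design $\mathcal{B}$ and a $(K',\Gamma')$-design $\mathcal{B}'$, a down-link from $\mathcal{B}$ to $\mathcal{B}'$ is a function $f:\mathcal{B}\to\mathcal{B}'$ such that $f(B)$ is a subgraph of $B$ for every $B\in\mathcal{B}$ (the vertex sets of $K$ and $K'$ need not coincide, and either may be the larger). Take $\Gamma'=P_3$. For $v$ such that a $(K_v,\Gamma)$-design exists: $\mathcal{L}_1\Gamma(v)$ is the set of all integers $n$ such that some $\Gamma$-design of order $v$ can be down-linked to a $P_3$-design of order $n$; $\mathcal{L}_2\Gamma(v)$ is the set of all integers $n$ such that every $\Gamma$-design of order $v$ can be down-linked to a $P_3$-design of order $n$. A $(K_v,P_k)$-design exists if and only if $v\geq k$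 and $v(v-1)\equiv 0\pmod{2(k-1)}$. *)

theory Defs
  imports Main "HOL-Library.FuncSet" "HOL-Library.Disjoint_Sets"
begin

type_synonym 'a sgraph = "'a set \<times> 'a set set"

abbreviation verts :: "'a sgraph \<Rightarrow> 'a set" where "verts \<equiv> fst"

abbreviation edges :: "'a sgraph \<Rightarrow> 'a set set" where "edges \<equiv> snd"

definition simple_graph :: "'a sgraph \<Rightarrow> bool" where
  "simple_graph G \<longleftrightarrow> finite (verts G) \<and> (\<forall>e\<in>edges G. e \<subseteq> verts G \<and> card e = 2)"

definition subgraph :: "'a sgraph \<Rightarrow> 'a sgraph \<Rightarrow> bool" where
  "subgraph H G \<longleftrightarrow>
     simple_graph H \<and> simple_graph G \<and> verts H \<subseteq> verts G \<and> edges H \<subseteq> edges G"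

definition graph_iso :: "'a sgraph \<Rightarrow> 'b sgraph \<Rightarrow> bool" where
  "graph_iso G H \<longleftrightarrow>
     (\<exists>\<phi>. bij_betw \<phi> (verts G) (verts H) \<and> edges H = (\<lambda>e. \<phi> ` e) ` edges G)"

definition complete_graph :: "'a set \<Rightarrow> 'a sgraph" where
  "complete_graph V = (V, {e. e \<subseteq> V \<and> card e = 2})"

(* the path on k vertices, hence with k - 1 edges *)
definition path_graph :: "nat \<Rightarrow> nat sgraph" where
  "path_graph k = ({..<k}, {{i, Suc i} | i. Suc i < k})"

definition design :: "'a sgraph \<Rightarrow> 'b sgraph \<Rightarrow> 'a sgraph set \<Rightarrow> bool" where
  "design K \<Gamma> \<B> \<longleftrightarrow>
     (\<forall>B\<in>\<B>. subgraph B K \<and> graph_iso B \<Gamma>) \<and>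
     disjoint_family_on edges \<B> \<and> (\<Union>B\<in>\<B>. edges B) = edges K"

definition design_of_order :: "'b sgraph \<Rightarrow> nat \<Rightarrow> 'a sgraph set \<Rightarrow> bool" where
  "design_of_order \<Gamma> n \<B> \<longleftrightarrow>
     (\<exists>V. finite V \<and> card V = n \<and> design (complete_graph V) \<Gamma> \<B>)"

definition down_link :: "('a sgraph \<Rightarrow> 'a sgraph) \<Rightarrow> 'a sgraph set \<Rightarrow> 'a sgraph set \<Rightarrow> bool" where
  "down_link f \<B> \<B>' \<longleftrightarrow> f \<in> \<B> \<rightarrow> \<B>' \<and> (\<forall>B\<in>\<B>. subgraph (f B) B)"

(* Both designs must live in a common universe of vertices, since the image of a block
   is a subgraph of it. As an n-element vertex set we allow every n-element
   subset of nat; the two vertex sets are chosen independently. *)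
definition \<L>1 :: "'b sgraph \<Rightarrow> nat \<Rightarrow> nat set" where
  "\<L>1 \<Gamma> v = {n. \<exists>\<B> :: nat sgraph set. design_of_order \<Gamma> v \<B> \<and>
     (\<exists>\<B>' f. design_of_order (path_graph 3) n \<B>' \<and> down_link f \<B> \<B>')}"

definition \<L>2 :: "'b sgraph \<Rightarrow> nat \<Rightarrow> nat set" where
  "\<L>2 \<Gamma> v = {n. \<forall>\<B> :: nat sgraph set. design_of_order \<Gamma> v \<B> \<longrightarrow>
     (\<exists>\<B>' f. design_of_order (path_graph 3) n \<B>' \<and> down_link f \<B> \<B>')}"

end

theory Submission imports Defs
begin

text \<open>A down-link drops an end edge of every \<open>P\<^sub>4\<close>. An edge \<open>xy\<close> with both ends missing from the
  \<open>P\<^sub>3\<close>-design would have to be dropped, but then the image of its block still meets \<open>{x, y}\<close>;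
  hence at most one vertex is missing, and it is never internal in a block. This gives
  \<open>n \<ge> v - 1\<close>, and \<open>n \<ge> v\<close> as soon as every vertex is internal in some block.

  Conversely, if \<open>n > v\<close> the edges of \<open>K\<^sub>n\<close> outside the image form a graph with a vertex adjacent
  to all others and with an even number of edges, and such a graph decomposes into copies of
  \<open>P\<^sub>3\<close>. For \<open>n \<in> {v - 1, v}\<close> designs are glued together: \<open>K\<^bsub>2,3\<^esub>\<close> consists of two \<open>P\<^sub>4\<close> whose dropped
  edges form a \<open>P\<^sub>3\<close>, so complete bipartite graphs with suitable parts are down-linked to
  themselves, which allows one to add 12 vertices at a time to finitely many small designs.\<close>

section \<open>Paths\<close>

definition path3 :: "'a \<Rightarrow> 'a \<Rightarrow> 'a \<Rightarrow> 'a sgraph" where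
  "path3 a b c = ({a, b, c}, {{a, b}, {b, c}})"

definition path4 :: "'a \<Rightarrow> 'a \<Rightarrow> 'a \<Rightarrow> 'a \<Rightarrow> 'a sgraph" where
  "path4 a b c d = ({a, b, c, d}, {{a, b}, {b, c}, {c, d}})"

definition is_path3 :: "'a sgraph \<Rightarrow> bool" where
  "is_path3 G \<longleftrightarrow> (\<exists>a b c. distinct [a, b, c] \<and> G = path3 a b c)"

definition is_path4 :: "'a sgraph \<Rightarrow> bool" where
  "is_path4 G \<longleftrightarrow> (\<exists>a b c d. distinct [a, b, c, d] \<and> G = path4 a b c d)"

lemma edges_path_graph: "edges (path_graph (Suc k)) = (\<lambda>i. {i, Suc i}) ` {..<k}"
  by (auto simp: path_graph_def)

lemma edges_path_graph_3: "edges (path_graph 3) = {{0, 1}, {1, 2}}"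
  using edges_path_graph[of 2] by (auto simp: numeral_3_eq_3 numeral_2_eq_2 lessThan_Suc)

lemma edges_path_graph_4: "edges (path_graph 4) = {{0, 1}, {1, 2}, {2, 3}}"
  using edges_path_graph[of 3] by (auto simp: eval_nat_numeral lessThan_Suc)

lemma verts_path_graph_3: "verts (path_graph 3) = {0, 1, 2}"
  by (auto simp: path_graph_def)

lemma verts_path_graph_4: "verts (path_graph 4) = {0, 1, 2, 3}"
  by (auto simp: path_graph_def)

text \<open>Turning the isomorphism around presents \<open>G\<close> as an image of the concrete
  graph \<open>H\<close>, so the numbered vertices of \<open>path_graph\<close> give names to the
  vertices of a block. Simplicity of \<open>G\<close> keeps its edges inside \<open>verts G\<close>,
  where the inverse cancels.\<close>

lemma graph_iso_inverse:
  assumes "simple_graph G" "graph_iso G H"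
  obtains \<psi> where "inj_on \<psi> (verts H)" "G = (\<psi> ` verts H, (\<lambda>e. \<psi> ` e) ` edges H)"
proof -
  obtain \<phi> where \<phi>: "bij_betw \<phi> (verts G) (verts H)" "edges H = (\<lambda>e. \<phi> ` e) ` edges G"
    using assms(2) unfolding graph_iso_def by blast
  define \<psi> where "\<psi> = inv_into (verts G) \<phi>"
  have \<psi>: "bij_betw \<psi> (verts H) (verts G)"
    unfolding \<psi>_def by (rule bij_betw_inv_into[OF \<phi>(1)])
  have inv: "\<psi> ` \<phi> ` e = e" if "e \<in> edges G" for e
  proof -
    have "e \<subseteq> verts G"
      using assms(1) that by (auto simp: simple_graph_def)
    then show ?thesis
      using \<phi>(1) unfolding \<psi>_def by (auto simp: bij_betw_def inv_into_image_cancel)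
  qed
  have "(\<lambda>e. \<psi> ` e) ` edges H = edges G"
    unfolding \<phi>(2) image_comp by (rule image_cong[of _ _ _ id, simplified]) (simp_all add: inv)
  then have "G = (\<psi> ` verts H, (\<lambda>e. \<psi> ` e) ` edges H)"
    using \<psi> by (simp add: bij_betw_def)
  with \<psi> show thesis
    using that by (auto simp: bij_betw_def)
qed

lemma simple_graph_path3: "is_path3 G \<Longrightarrow> simple_graph G"
  by (auto simp: is_path3_def path3_def simple_graph_def)

lemma simple_graph_path4: "is_path4 G \<Longrightarrow> simple_graph G"
  by (auto simp: is_path4_def path4_def simple_graph_def)

lemma is_path3_iff: "is_path3 G \<longleftrightarrow> simple_graph G \<and> graph_iso G (path_graph 3)"
proof
  assume G: "is_path3 G"
  then obtain a b c where abc: "distinct [a, b, c]" "G = path3 a b c"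
    unfolding is_path3_def by blast
  define \<phi> :: "'a \<Rightarrow> nat" where "\<phi> x = (if x = a then 0 else if x = b then 1 else 2)" for x
  have "bij_betw \<phi> (verts G) (verts (path_graph 3))"
    using abc unfolding verts_path_graph_3
    by (auto simp: bij_betw_def inj_on_def \<phi>_def path3_def)
  moreover have "edges (path_graph 3) = (\<lambda>e. \<phi> ` e) ` edges G"
    using abc unfolding edges_path_graph_3 by (auto simp: \<phi>_def path3_def)
  ultimately show "simple_graph G \<and> graph_iso G (path_graph 3)"
    using simple_graph_path3[OF G] unfolding graph_iso_def by blast
next
  assume "simple_graph G \<and> graph_iso G (path_graph 3)"
  then obtain \<psi> where \<psi>: "inj_on \<psi> (verts (path_graph 3))"
    "G = (\<psi> ` verts (path_graph 3), (\<lambda>e. \<psi> ` e) ` edges (path_graph 3))"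
    using graph_iso_inverse by blast
  have "distinct [\<psi> 0, \<psi> 1, \<psi> 2]"
    using \<psi>(1) unfolding verts_path_graph_3 by (auto simp: inj_on_def)
  moreover have "G = path3 (\<psi> 0) (\<psi> 1) (\<psi> 2)"
    unfolding \<psi>(2) path3_def verts_path_graph_3 edges_path_graph_3 by simp
  ultimately show "is_path3 G"
    unfolding is_path3_def by blast
qed

lemma is_path4_iff: "is_path4 G \<longleftrightarrow> simple_graph G \<and> graph_iso G (path_graph 4)"
proof
  assume G: "is_path4 G"
  then obtain a b c d where abcd: "distinct [a, b, c, d]" "G = path4 a b c d"
    unfolding is_path4_def by blast
  define \<phi> :: "'a \<Rightarrow> nat"
    where "\<phi> x = (if x = a then 0 else if x = b then 1 else if x = c then 2 else 3)" for x
  have "bij_betw \<phi> (verts G) (verts (path_graph 4))"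
    using abcd unfolding verts_path_graph_4
    by (auto simp: bij_betw_def inj_on_def \<phi>_def path4_def)
  moreover have "edges (path_graph 4) = (\<lambda>e. \<phi> ` e) ` edges G"
    using abcd unfolding edges_path_graph_4 by (auto simp: \<phi>_def path4_def)
  ultimately show "simple_graph G \<and> graph_iso G (path_graph 4)"
    using simple_graph_path4[OF G] unfolding graph_iso_def by blast
next
  assume "simple_graph G \<and> graph_iso G (path_graph 4)"
  then obtain \<psi> where \<psi>: "inj_on \<psi> (verts (path_graph 4))"
    "G = (\<psi> ` verts (path_graph 4), (\<lambda>e. \<psi> ` e) ` edges (path_graph 4))"
    using graph_iso_inverse by blast
  have "distinct [\<psi> 0, \<psi> 1, \<psi> 2, \<psi> 3]"
    using \<psi>(1) unfolding verts_path_graph_4 by (auto simp: inj_on_def)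
  moreover have "G = path4 (\<psi> 0) (\<psi> 1) (\<psi> 2) (\<psi> 3)"
    unfolding \<psi>(2) path4_def verts_path_graph_4 edges_path_graph_4 by simp
  ultimately show "is_path4 G"
    unfolding is_path4_def by blast
qed

section \<open>Decompositions of edge sets\<close>

text \<open>No host graph occurs, only an edge set and a shape for the blocks; edge-disjoint pieces
  can then be united without regard to their vertex sets.\<close>

definition decomposes :: "('a sgraph \<Rightarrow> bool) \<Rightarrow> 'a set set \<Rightarrow> 'a sgraph set \<Rightarrow> bool" where
  "decomposes P E \<B> \<longleftrightarrow>
     (\<forall>B\<in>\<B>. P B) \<and> disjoint_family_on edges \<B> \<and> (\<Union>B\<in>\<B>. edges B) = E"

definition pairs_of :: "'a set \<Rightarrow> 'a set set" where
  "pairs_of V = {e. e \<subseteq> V \<and> card e = 2}"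

lemma complete_graph_eq: "complete_graph V = (V, pairs_of V)"
  by (simp add: complete_graph_def pairs_of_def)

lemma finite_pairs_of: "finite V \<Longrightarrow> finite (pairs_of V)"
  unfolding pairs_of_def by (rule finite_subset[of _ "Pow V"]) auto

lemma card_pairs_of: "finite V \<Longrightarrow> card (pairs_of V) = card V choose 2"
  unfolding pairs_of_def by (rule n_subsets)

lemma doubleton_in_pairs_of [simp]: "{a, b} \<in> pairs_of V \<longleftrightarrow> a \<in> V \<and> b \<in> V \<and> a \<noteq> b"
  by (auto simp: pairs_of_def card_2_iff)

lemma pairs_ofE:
  assumes "e \<in> pairs_of V" obtains a b where "e = {a, b}" "a \<in> V" "b \<in> V" "a \<noteq> b"
  using assms unfolding pairs_of_def by (auto simp: card_2_iff)

lemma pairs_of_mono: "V \<subseteq> W \<Longrightarrow> pairs_of V \<subseteq> pairs_of W"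
  unfolding pairs_of_def by auto

text \<open>Every vertex of a path lies on an edge, so placing the edges in
  \<open>pairs_of V\<close> also places the vertices in \<open>V\<close>.\<close>

lemma subgraph_complete_path:
  assumes "finite V" "is_path3 G \<or> is_path4 G" "edges G \<subseteq> pairs_of V"
  shows "subgraph G (complete_graph V)"
proof -
  have "simple_graph (complete_graph V)"
    using assms(1) by (auto simp: simple_graph_def complete_graph_def)
  moreover have "verts G \<subseteq> V"
    using assms(2,3) by (auto simp: is_path3_def is_path4_def path3_def path4_def)
  ultimately show ?thesis
    using assms(2,3) simple_graph_path3[of G] simple_graph_path4[of G]
    by (auto simp: subgraph_def complete_graph_eq)
qed

lemma design_path3_iff:
  assumes "finite V"
  shows "design (complete_graph V) (path_graph 3) \<B> \<longleftrightarrow> decomposes is_path3 (pairs_of V) \<B>"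
proof
  assume "design (complete_graph V) (path_graph 3) \<B>"
  then show "decomposes is_path3 (pairs_of V) \<B>"
    unfolding design_def decomposes_def complete_graph_eq is_path3_iff subgraph_def by simp
next
  assume D: "decomposes is_path3 (pairs_of V) \<B>"
  then have "subgraph B (complete_graph V)" if "B \<in> \<B>" for B
    using that assms by (intro subgraph_complete_path) (auto simp: decomposes_def)
  with D show "design (complete_graph V) (path_graph 3) \<B>"
    unfolding design_def decomposes_def is_path3_iff by (simp add: complete_graph_eq)
qed

lemma design_path4_iff:
  assumes "finite V"
  shows "design (complete_graph V) (path_graph 4) \<B> \<longleftrightarrow> decomposes is_path4 (pairs_of V) \<B>"
proof
  assume "design (complete_graph V) (path_graph 4) \<B>"
  then show "decomposes is_path4 (pairs_of V) \<B>"
    unfolding design_def decomposes_def complete_graph_eq is_path4_iff subgraph_def by simp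
next
  assume D: "decomposes is_path4 (pairs_of V) \<B>"
  then have "subgraph B (complete_graph V)" if "B \<in> \<B>" for B
    using that assms by (intro subgraph_complete_path) (auto simp: decomposes_def)
  with D show "design (complete_graph V) (path_graph 4) \<B>"
    unfolding design_def decomposes_def is_path4_iff by (simp add: complete_graph_eq)
qed

section \<open>Uniting decompositions and counting their edges\<close>

lemma decomposes_empty: "decomposes P {} {}"
  by (simp add: decomposes_def disjoint_family_on_def)

lemma decomposes_single: "P B \<Longrightarrow> decomposes P (edges B) {B}"
  by (simp add: decomposes_def disjoint_family_on_def)

lemma decomposes_Un:
  assumes "decomposes P E \<B>" "decomposes P F \<C>" "E \<inter> F = {}"
  shows "decomposes P (E \<union> F) (\<B> \<union> \<C>)"
proof -
  have cross: "edges B \<inter> edges C = {}" if "B \<in> \<B>" "C \<in> \<C>" for B C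
    using assms that unfolding decomposes_def by blast
  have "disjoint_family_on edges (\<B> \<union> \<C>)"
    unfolding disjoint_family_on_def
  proof (intro ballI impI)
    fix B C assume BC: "B \<in> \<B> \<union> \<C>" "C \<in> \<B> \<union> \<C>" "B \<noteq> C"
    then consider "B \<in> \<B>" "C \<in> \<B>" | "B \<in> \<C>" "C \<in> \<C>" | "B \<in> \<B>" "C \<in> \<C>"
      | "B \<in> \<C>" "C \<in> \<B>"
      by blast
    then show "edges B \<inter> edges C = {}"
    proof cases
      case 1
      with assms(1) BC show ?thesis by (simp add: decomposes_def disjoint_family_on_def)
    next
      case 2
      with assms(2) BC show ?thesis by (simp add: decomposes_def disjoint_family_on_def)
    next
      case 3
      then show ?thesis by (rule cross)
    next
      case 4
      with cross[of C B] show ?thesis by (simp add: Int_commute)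
    qed
  qed
  moreover have "\<forall>B\<in>\<B> \<union> \<C>. P B" "(\<Union>B\<in>\<B> \<union> \<C>. edges B) = E \<union> F"
    using assms(1,2) unfolding decomposes_def by blast+
  ultimately show ?thesis
    unfolding decomposes_def by blast
qed

lemma card_decomposes:
  assumes "finite E" "decomposes P E \<B>" "\<And>B. P B \<Longrightarrow> card (edges B) = k" "0 < k"
  shows "card E = k * card \<B>"
proof -
  have E: "E = (\<Union>B\<in>\<B>. edges B)" and P: "\<And>B. B \<in> \<B> \<Longrightarrow> card (edges B) = k"
    and dis: "disjoint_family_on edges \<B>"
    using assms unfolding decomposes_def by auto
  \<comment> \<open>Two different blocks with the same edge set would be disjoint from themselves,
    hence without edges, against \<open>0 < k\<close>.\<close>
  have "inj_on edges \<B>"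
  proof (rule inj_onI, rule ccontr)
    fix B C assume *: "B \<in> \<B>" "C \<in> \<B>" "edges B = edges C" "B \<noteq> C"
    then have "edges B = {}"
      using dis unfolding disjoint_family_on_def by blast
    with P[OF *(1)] \<open>0 < k\<close> show False by simp
  qed
  moreover have "edges ` \<B> \<subseteq> Pow E"
    using E by auto
  ultimately have "finite \<B>"
    using \<open>finite E\<close> by (meson finite_Pow_iff finite_subset inj_on_finite)
  have "card E = (\<Sum>B\<in>\<B>. card (edges B))"
    unfolding E
  proof (rule card_UN_disjoint)
    \<comment> \<open>An infinite edge set would have \<open>card\<close> 0, which is not
      \<open>k\<close>.\<close>
    show "\<forall>B\<in>\<B>. finite (edges B)"
      using P \<open>0 < k\<close> by (metis card.infinite less_irrefl)
    show "\<forall>B\<in>\<B>. \<forall>C\<in>\<B>. B \<noteq> C \<longrightarrow> edges B \<inter> edges C = {}"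
      using dis unfolding disjoint_family_on_def by blast
  qed fact
  then show ?thesis
    using P by simp
qed

lemma card_edges_path3: "is_path3 B \<Longrightarrow> card (edges B) = 2"
  by (auto simp: is_path3_def path3_def doubleton_eq_iff)

lemma card_edges_path4: "is_path4 B \<Longrightarrow> card (edges B) = 3"
  by (auto simp: is_path4_def path4_def doubleton_eq_iff card_insert_if)

lemma down_linkE:
  assumes "down_link f \<B> \<C>" "decomposes is_path3 F \<C>" "B \<in> \<B>"
  obtains p q r where "f B = path3 p q r" "distinct [p, q, r]" "edges (f B) \<subseteq> F"
    "edges (f B) \<subseteq> edges B"
  using assms unfolding down_link_def decomposes_def is_path3_def subgraph_def by blast

section \<open>Linked decompositions\<close>

text \<open>The set \<^term>\<open>C\<close> collects vertices that are internal in some block of the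
  \<open>P\<^sub>4\<close>-decomposition; no such vertex can be missing from the vertices of the linked
  \<open>P\<^sub>3\<close>-decomposition.\<close>

definition linkable :: "'a set \<Rightarrow> 'a set set \<Rightarrow> 'a set set \<Rightarrow> bool" where
  "linkable C E F \<longleftrightarrow> (\<exists>\<B> \<B>' f. decomposes is_path4 E \<B> \<and> decomposes is_path3 F \<B>' \<and>
     down_link f \<B> \<B>' \<and> (\<forall>y\<in>C. \<exists>a c d. distinct [a, y, c, d] \<and> path4 a y c d \<in> \<B>))"

text \<open>The gluing principle behind all constructions. The two sides need separate disjointness
  conditions because \<open>F\<close> need not lie inside \<open>E\<close>.\<close>

lemma linkable_Un:
  assumes "linkable C1 E1 F1" "linkable C2 E2 F2" "E1 \<inter> E2 = {}" "F1 \<inter> F2 = {}"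
  shows "linkable (C1 \<union> C2) (E1 \<union> E2) (F1 \<union> F2)"
proof -
  obtain \<B>1 \<C>1 f1 where 1: "decomposes is_path4 E1 \<B>1" "decomposes is_path3 F1 \<C>1"
    "down_link f1 \<B>1 \<C>1" "\<forall>y\<in>C1. \<exists>a c d. distinct [a, y, c, d] \<and> path4 a y c d \<in> \<B>1"
    using assms(1) unfolding linkable_def by blast
  obtain \<B>2 \<C>2 f2 where 2: "decomposes is_path4 E2 \<B>2" "decomposes is_path3 F2 \<C>2"
    "down_link f2 \<B>2 \<C>2" "\<forall>y\<in>C2. \<exists>a c d. distinct [a, y, c, d] \<and> path4 a y c d \<in> \<B>2"
    using assms(2) unfolding linkable_def by blast
  have "down_link (\<lambda>B. if B \<in> \<B>1 then f1 B else f2 B) (\<B>1 \<union> \<B>2) (\<C>1 \<union> \<C>2)"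
    using 1(3) 2(3) unfolding down_link_def Pi_iff by auto
  then show ?thesis
    unfolding linkable_def
    using decomposes_Un[OF 1(1) 2(1) assms(3)] decomposes_Un[OF 1(2) 2(2) assms(4)] 1(4) 2(4)
    by (intro exI[of _ "\<B>1 \<union> \<B>2"] exI[of _ "\<C>1 \<union> \<C>2"]) blast
qed

lemma linkable_mono: "linkable C E F \<Longrightarrow> D \<subseteq> C \<Longrightarrow> linkable D E F"
  unfolding linkable_def by blast

lemma linkable_path4:
  assumes "distinct [a, b, c, d]"
  shows "linkable {b, c} {{a, b}, {b, c}, {c, d}} {{b, c}, {c, d}}"
proof -
  have P: "is_path4 (path4 a b c d)" "is_path3 (path3 b c d)"
    using assms unfolding is_path4_def is_path3_def by auto
  have "down_link (\<lambda>_. path3 b c d) {path4 a b c d} {path3 b c d}"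
    using simple_graph_path3[OF P(2)] simple_graph_path4[OF P(1)]
    unfolding down_link_def subgraph_def by (auto simp: path3_def path4_def)
  moreover have "\<exists>a' c' d'. distinct [a', y, c', d'] \<and> path4 a' y c' d' \<in> {path4 a b c d}"
    if "y \<in> {b, c}" for y
  proof (cases "y = b")
    case True
    then show ?thesis
      using assms by blast
  next
    case False
    \<comment> \<open>\<open>linkable\<close> asks for a member of \<open>C\<close> in second
      position; reading the path backwards puts \<open>c\<close> there.\<close>
    moreover have "path4 d c b a = path4 a b c d"
      by (auto simp: path4_def)
    ultimately show ?thesis
      using assms that by (intro exI[of _ d] exI[of _ b] exI[of _ a]) auto
  qed
  ultimately show ?thesis
    unfolding linkable_def
    using decomposes_single[of is_path4, OF P(1)] decomposes_single[of is_path3, OF P(2)]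
    by (intro exI[of _ "{path4 a b c d}"] exI[of _ "{path3 b c d}"] exI[of _ "\<lambda>_. path3 b c d"])
      (simp add: path3_def path4_def)
qed

text \<open>With no \<open>P_4\<close> block at all, a \<open>P_3\<close>-decomposition is linked
  trivially. Such pieces fill up the part of the \<open>P_3\<close>-design outside the image of the
  down-link.\<close>

lemma linkable_decomposes:
  assumes "decomposes is_path3 F \<B>" shows "linkable {} {} F"
  unfolding linkable_def
  by (rule exI[of _ "{}"], rule exI[of _ \<B>], rule exI[of _ id])
    (simp add: assms decomposes_empty down_link_def)

lemma linkable_empty: "linkable {} {} {}"
  by (rule linkable_decomposes[OF decomposes_empty])

lemma linkable_path3: "distinct [a, b, c] \<Longrightarrow> linkable {} {} {{a, b}, {b, c}}"
  using linkable_decomposes[OF decomposes_single[of is_path3 "path3 a b c"]]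
  by (fastforce simp: is_path3_def path3_def)

section \<open>Complete bipartite graphs\<close>

definition bip :: "'a set \<Rightarrow> 'a set \<Rightarrow> 'a set set" where
  "bip A B = (\<lambda>(a, b). {a, b}) ` (A \<times> B)"

lemma bip_commute: "bip A B = bip B A"
  by (auto simp: bip_def image_iff insert_commute)

lemma bip_empty_right: "bip A {} = {}"
  by (simp add: bip_def)

lemma bip_Un_right: "bip A (B \<union> C) = bip A B \<union> bip A C"
  by (auto simp: bip_def)

lemma bip_disjoint_right:
  assumes "A \<inter> C = {}" "B \<inter> C = {}"
  shows "bip A B \<inter> bip A C = {}"
  using assms by (auto simp: bip_def doubleton_eq_iff)

lemma pairs_of_Un: "A \<inter> B = {} \<Longrightarrow> pairs_of (A \<union> B) = pairs_of A \<union> (pairs_of B \<union> bip A B)"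
proof (intro equalityI subsetI)
  fix e assume "A \<inter> B = {}" "e \<in> pairs_of (A \<union> B)"
  then show "e \<in> pairs_of A \<union> (pairs_of B \<union> bip A B)"
    by (elim pairs_ofE) (auto simp: bip_def image_iff insert_commute)
next
  fix e assume "A \<inter> B = {}" "e \<in> pairs_of A \<union> (pairs_of B \<union> bip A B)"
  then show "e \<in> pairs_of (A \<union> B)"
    using pairs_of_mono[of A "A \<union> B"] pairs_of_mono[of B "A \<union> B"] by (auto simp: bip_def)
qed

text \<open>A common edge would need two common vertices. One common vertex \<open>x\<close> is
  allowed, since \<open>linkable_one_less\<close> glues two complete graphs that share the missing
  vertex.\<close>

lemma pairs_of_disjoint: "A \<inter> B \<subseteq> {x} \<Longrightarrow> pairs_of A \<inter> pairs_of B = {}"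
  by (auto elim!: pairs_ofE simp: doubleton_eq_iff) blast+

lemma pairs_of_bip_disjoint: "C \<inter> B = {} \<Longrightarrow> pairs_of C \<inter> bip A B = {}"
  by (auto elim!: pairs_ofE simp: bip_def doubleton_eq_iff)

lemma split_set_card:
  assumes "finite B" "card B = k + m"
  obtains C D where "B = C \<union> D" "C \<inter> D = {}" "card C = k" "card D = m" "finite C" "finite D"
proof -
  obtain C where C: "C \<subseteq> B" "card C = k" "finite C"
    using obtain_subset_with_card_n[of k B] assms by auto
  then show thesis
    using assms by (intro that[of C "B - C"]) (auto simp: card_Diff_subset)
qed

lemma linkable_self_Un:
  "linkable {} E E \<Longrightarrow> linkable {} F F \<Longrightarrow> E \<inter> F = {} \<Longrightarrow> linkable {} (E \<union> F) (E \<union> F)"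
  using linkable_Un[of "{}" E E "{}" F F] by simp

lemma linkable_bip_2_3:
  assumes "card A = 2" "card B = 3" "A \<inter> B = {}"
  shows "linkable {} (bip A B) (bip A B)"
proof -
  obtain p q where A: "A = {p, q}" "p \<noteq> q"
    using assms(1) by (auto simp: card_2_iff)
  obtain x y z where B: "B = {x, y, z}" "x \<noteq> y" "x \<noteq> z" "y \<noteq> z"
    using assms(2) by (auto simp: card_3_iff)
  have d: "distinct [p, q, x, y, z]"
    using assms(3) A B by auto
  \<comment> \<open>The blocks are x-p-y-q and x-q-z-p. Each loses its first edge, and the lost
    edges xp and xq form the path p-x-q.\<close>
  have "linkable ({} \<union> ({} \<union> {}))
    ({{x, p}, {p, y}, {y, q}} \<union> ({{x, q}, {q, z}, {z, p}} \<union> {}))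
    ({{p, y}, {y, q}} \<union> ({{q, z}, {z, p}} \<union> {{p, x}, {x, q}}))"
    using d
    by (intro linkable_Un linkable_path3 linkable_mono[OF linkable_path4])
      (auto simp: doubleton_eq_iff)
  moreover have "bip A B = {{x, p}, {p, y}, {y, q}} \<union> ({{x, q}, {q, z}, {z, p}} \<union> {})"
    "bip A B = {{p, y}, {y, q}} \<union> ({{q, z}, {z, p}} \<union> {{p, x}, {x, q}})"
    unfolding A B bip_def by (auto simp: insert_commute)
  ultimately show ?thesis
    by simp
qed

lemma linkable_bip_2_mult3:
  assumes "card A = 2" "finite B" "card B = 3 * k" "A \<inter> B = {}"
  shows "linkable {} (bip A B) (bip A B)"
  using assms(2-4)
proof (induction k arbitrary: B)
  case 0
  then show ?case
    by (simp add: bip_empty_right linkable_empty)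
next
  case (Suc k)
  then obtain C D where CD: "B = C \<union> D" "C \<inter> D = {}" "card C = 3" "card D = 3 * k" "finite D"
    by (metis mult_Suc_right split_set_card)
  show ?case
    unfolding CD(1) bip_Un_right
  proof (rule linkable_self_Un)
    show "linkable {} (bip A C) (bip A C)"
      using assms(1) CD Suc.prems by (intro linkable_bip_2_3) auto
    show "linkable {} (bip A D) (bip A D)"
      using CD Suc.prems by (intro Suc.IH) auto
    show "bip A C \<inter> bip A D = {}"
      using CD Suc.prems by (intro bip_disjoint_right) auto
  qed
qed

lemma linkable_bip:
  assumes "finite A" "card A = 2 * j" "finite B" "card B = 3 * k" "A \<inter> B = {}"
  shows "linkable {} (bip A B) (bip A B)"
  using assms(1,2,5)
proof (induction j arbitrary: A)
  case 0
  then show ?case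
    by (simp add: bip_commute[of "{}"] bip_empty_right linkable_empty)
next
  case (Suc j)
  then obtain C D where CD: "A = C \<union> D" "C \<inter> D = {}" "card C = 2" "card D = 2 * j" "finite D"
    by (metis mult_Suc_right split_set_card)
  show ?case
    unfolding CD(1) bip_commute[of _ B] bip_Un_right
  proof (rule linkable_self_Un)
    show "linkable {} (bip B C) (bip B C)"
      unfolding bip_commute[of B]
      using assms CD Suc.prems by (intro linkable_bip_2_mult3) auto
    show "linkable {} (bip B D) (bip B D)"
      unfolding bip_commute[of B]
      using CD Suc.prems by (intro Suc.IH) auto
    show "bip B C \<inter> bip B D = {}"
      using CD Suc.prems by (intro bip_disjoint_right) auto
  qed
qed

text \<open>A multiple of six can play either part in \<open>linkable_bip\<close>. If
  \<open>card B\<close> is even, \<open>B\<close> is the even part. If it is odd, it is at least 3,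
  and \<open>B\<close> is cut into a triple, against which \<open>A\<close> is the even part, and a
  remainder of even size.\<close>

lemma linkable_bip_mult6:
  assumes "finite A" "6 dvd card A" "finite B" "2 \<le> card B" "A \<inter> B = {}"
  shows "linkable {} (bip A B) (bip A B)"
proof -
  obtain t where t: "card A = 6 * t"
    using assms(2) by (elim dvdE)
  have even_case: "linkable {} (bip A D) (bip A D)"
    if "finite D" "even (card D)" "A \<inter> D = {}" for D
  proof -
    obtain s where "card D = 2 * s"
      using \<open>even (card D)\<close> by (elim evenE)
    then show ?thesis
      unfolding bip_commute[of A]
      using that assms(1) t by (intro linkable_bip[of _ s _ "2 * t"]) auto
  qed
  show ?thesis
  proof (cases "even (card B)")
    case True
    then show ?thesis
      using even_case assms by blast
  next
    case False
    then have "card B = 3 + (card B - 3)" "even (card B - 3)"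
      using assms(4) by presburger+
    then obtain C D where CD: "B = C \<union> D" "C \<inter> D = {}" "card C = 3" "even (card D)"
      "finite C" "finite D"
      by (metis assms(3) split_set_card)
    show ?thesis
      unfolding CD(1) bip_Un_right
    proof (rule linkable_self_Un)
      show "linkable {} (bip A C) (bip A C)"
        using assms CD t by (intro linkable_bip[of _ "3 * t" _ 1]) auto
      show "linkable {} (bip A D) (bip A D)"
        using assms CD by (intro even_case) auto
      show "bip A C \<inter> bip A D = {}"
        using assms CD by (intro bip_disjoint_right) auto
    qed
  qed
qed

section \<open>Explicit linked decompositions of small complete graphs\<close>

text \<open>A list of quadruples \<open>(a, b, c, d)\<close> stands for blocks \<open>a - b - c - d\<close> that lose the edge
  \<open>ab\<close> under the down-link, a list of triples for the blocks of the \<open>P\<^sub>3\<close>-decomposition outside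
  the image. Edges are ordered pairs, so that the conditions reduce to distinctness of lists.\<close>

definition nedge :: "nat \<Rightarrow> nat \<Rightarrow> nat \<times> nat" where
  "nedge a b = (min a b, max a b)"

fun p4_edges :: "nat \<times> nat \<times> nat \<times> nat \<Rightarrow> (nat \<times> nat) list" where
  "p4_edges (a, b, c, d) = [nedge a b, nedge b c, nedge c d]"

fun kept_edges :: "nat \<times> nat \<times> nat \<times> nat \<Rightarrow> (nat \<times> nat) list" where
  "kept_edges (a, b, c, d) = [nedge b c, nedge c d]"

fun p3_edges :: "nat \<times> nat \<times> nat \<Rightarrow> (nat \<times> nat) list" where
  "p3_edges (a, b, c) = [nedge a b, nedge b c]"

fun inner :: "nat \<times> nat \<times> nat \<times> nat \<Rightarrow> nat list" where
  "inner (a, b, c, d) = [b, c]"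

text \<open>The numbers from \<open>m\<close> to \<open>n - 1\<close> are the vertices missing from
  the \<open>P_3\<close>-design; only the end \<open>a\<close>, which belongs to the lost edge
  alone, may be one of them.\<close>

fun p4_ok :: "nat \<Rightarrow> nat \<Rightarrow> nat \<times> nat \<times> nat \<times> nat \<Rightarrow> bool" where
  "p4_ok n m (a, b, c, d) \<longleftrightarrow> distinct [a, b, c, d] \<and> a < n \<and> b < m \<and> c < m \<and> d < m"

fun p3_ok :: "nat \<Rightarrow> nat \<times> nat \<times> nat \<Rightarrow> bool" where
  "p3_ok m (a, b, c) \<longleftrightarrow> distinct [a, b, c] \<and> a < m \<and> b < m \<and> c < m"

section \<open>Transport of the lists to edge sets\<close>

definition edge_image :: "(nat \<Rightarrow> 'a) \<Rightarrow> (nat \<times> nat) list \<Rightarrow> 'a set set" where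
  "edge_image \<phi> xs = (\<lambda>(a, b). {\<phi> a, \<phi> b}) ` set xs"

lemma edge_image_simps [simp]:
  "edge_image \<phi> [] = {}"
  "edge_image \<phi> (nedge a b # xs) = insert {\<phi> a, \<phi> b} (edge_image \<phi> xs)"
  "edge_image \<phi> (xs @ ys) = edge_image \<phi> xs \<union> edge_image \<phi> ys"
  by (auto simp: edge_image_def nedge_def min_def max_def insert_commute)

text \<open>An unordered pair determines its increasing arrangement; this is why the lists hold
  values of \<open>nedge\<close>.\<close>

lemma inj_on_edge_image:
  fixes \<phi> :: "nat \<Rightarrow> 'a"
  assumes "inj_on \<phi> {..<n}"
  shows "inj_on (\<lambda>(a, b). {\<phi> a, \<phi> b}) {(a, b). a < b \<and> b < n}"
proof -
  have "a = c \<and> b = d"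
    if "{\<phi> a, \<phi> b} = {\<phi> c, \<phi> d}" "a < b" "b < n" "c < d" "d < n" for a b c d
  proof -
    have "\<phi> x = \<phi> y \<longleftrightarrow> x = y" if "x < n" "y < n" for x y
      using assms that by (simp add: inj_on_eq_iff)
    with that show ?thesis
      by (auto simp: doubleton_eq_iff)
  qed
  then show ?thesis
    unfolding inj_on_def by fastforce
qed

lemma edge_image_disjoint:
  assumes "inj_on \<phi> {..<n}" "set xs \<subseteq> {(a, b). a < b \<and> b < n}"
    "set ys \<subseteq> {(a, b). a < b \<and> b < n}" "set xs \<inter> set ys = {}"
  shows "edge_image \<phi> xs \<inter> edge_image \<phi> ys = {}"
  using inj_on_image_Int[OF inj_on_edge_image[OF assms(1)] assms(2,3)] assms(4)
  by (simp add: edge_image_def)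

text \<open>By counting: distinct pairs, as many as \<open>K_n\<close> has edges, exhaust it. So
  covering every edge is checked by distinctness and a length only.\<close>

lemma edge_image_complete:
  assumes "inj_on \<phi> {..<n}" "set xs \<subseteq> {(a, b). a < b \<and> b < n}" "distinct xs"
    "length xs = n choose 2"
  shows "edge_image \<phi> xs = pairs_of (\<phi> ` {..<n})"
proof (rule card_subset_eq)
  show "finite (pairs_of (\<phi> ` {..<n}))"
    by (simp add: finite_pairs_of)
  show "edge_image \<phi> xs \<subseteq> pairs_of (\<phi> ` {..<n})"
    using assms(1,2) by (fastforce simp: edge_image_def inj_on_def)
  have "card (edge_image \<phi> xs) = card (set xs)"
    unfolding edge_image_def
    by (rule card_image[OF inj_on_subset[OF inj_on_edge_image[OF assms(1)] assms(2)]])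
  also have "\<dots> = card (pairs_of (\<phi> ` {..<n}))"
    using assms by (simp add: card_pairs_of distinct_card card_image)
  finally show "card (edge_image \<phi> xs) = card (pairs_of (\<phi> ` {..<n}))" .
qed

lemma p4_ok_edges:
  assumes "list_all (p4_ok n m) ts" "m \<le> n"
  shows "set (concat (map p4_edges ts)) \<subseteq> {(a, b). a < b \<and> b < n}"
    and "set (concat (map kept_edges ts)) \<subseteq> {(a, b). a < b \<and> b < m}"
  using assms by (fastforce simp: list_all_iff nedge_def min_def max_def)+

lemma p3_ok_edges:
  "list_all (p3_ok m) ts \<Longrightarrow> set (concat (map p3_edges ts)) \<subseteq> {(a, b). a < b \<and> b < m}"
  by (fastforce simp: list_all_iff nedge_def min_def max_def)

lemma kept_edges_subset: "set (concat (map kept_edges ts)) \<subseteq> set (concat (map p4_edges ts))"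
  by (induction ts rule: list.induct) (auto split: prod.splits)

lemma edge_image_mono: "set xs \<subseteq> set ys \<Longrightarrow> edge_image \<phi> xs \<subseteq> edge_image \<phi> ys"
  by (auto simp: edge_image_def)

lemma linkable_p4_list:
  assumes "inj_on \<phi> {..<n}" "m \<le> n" "list_all (p4_ok n m) ts"
    "distinct (concat (map p4_edges ts))"
  shows "linkable (\<phi> ` set (concat (map inner ts))) (edge_image \<phi> (concat (map p4_edges ts)))
    (edge_image \<phi> (concat (map kept_edges ts)))"
  using assms(3,4)
proof (induction ts)
  case Nil
  then show ?case
    by (simp add: linkable_empty)
next
  case (Cons t ts)
  obtain a b c d where t: "t = (a, b, c, d)"
    by (metis prod_cases4)
  have ok: "distinct [a, b, c, d]" "a < n" "b < n" "c < n" "d < n"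
    using Cons.prems(1) assms(2) by (auto simp: t)
  then have "distinct [\<phi> a, \<phi> b, \<phi> c, \<phi> d]"
    using assms(1) by (auto simp: inj_on_eq_iff)
  from linkable_path4[OF this]
  have 1: "linkable (\<phi> ` set (inner t)) (edge_image \<phi> (p4_edges t)) (edge_image \<phi> (kept_edges t))"
    by (simp add: t)
  have 2: "linkable (\<phi> ` set (concat (map inner ts))) (edge_image \<phi> (concat (map p4_edges ts)))
    (edge_image \<phi> (concat (map kept_edges ts)))"
    using Cons by simp
  have 3: "edge_image \<phi> (p4_edges t) \<inter> edge_image \<phi> (concat (map p4_edges ts)) = {}"
    using p4_ok_edges(1)[of n m "[t]"] p4_ok_edges(1)[of n m ts] Cons.prems assms(1,2)
    by (intro edge_image_disjoint[of _ n]) auto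
  have 4: "edge_image \<phi> (kept_edges t) \<inter> edge_image \<phi> (concat (map kept_edges ts)) = {}"
    using edge_image_mono[OF kept_edges_subset, of \<phi> "[t]"]
      edge_image_mono[OF kept_edges_subset, of \<phi> ts] 3 by auto
  show ?case
    using linkable_Un[OF 1 2 3 4] by (simp add: image_Un)
qed

lemma linkable_p3_list:
  assumes "inj_on \<phi> {..<m}" "list_all (p3_ok m) ts" "distinct (concat (map p3_edges ts))"
  shows "linkable {} {} (edge_image \<phi> (concat (map p3_edges ts)))"
  using assms(2,3)
proof (induction ts)
  case Nil
  then show ?case
    by (simp add: linkable_empty)
next
  case (Cons t ts)
  obtain a b c where t: "t = (a, b, c)"
    by (metis prod_cases3)
  have "distinct [a, b, c]" "a < m" "b < m" "c < m"
    using Cons.prems(1) by (auto simp: t)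
  then have "distinct [\<phi> a, \<phi> b, \<phi> c]"
    using assms(1) by (auto simp: inj_on_eq_iff)
  from linkable_path3[OF this] have 1: "linkable {} {} (edge_image \<phi> (p3_edges t))"
    by (simp add: t)
  have 2: "linkable {} {} (edge_image \<phi> (concat (map p3_edges ts)))"
    using Cons by simp
  have 3: "edge_image \<phi> (p3_edges t) \<inter> edge_image \<phi> (concat (map p3_edges ts)) = {}"
    using p3_ok_edges[of m "[t]"] p3_ok_edges[of m ts] Cons.prems assms(1)
    by (intro edge_image_disjoint[of _ m]) auto
  show ?case
    using linkable_Un[OF 1 2 _ 3] by simp
qed

lemma length_concat_p4_edges: "length (concat (map p4_edges ts)) = 3 * length ts"
  by (induction ts rule: list.induct) (auto split: prod.splits)

lemma length_concat_kept_edges: "length (concat (map kept_edges ts)) = 2 * length ts"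
  by (induction ts rule: list.induct) (auto split: prod.splits)

lemma length_concat_p3_edges: "length (concat (map p3_edges ts)) = 2 * length ts"
  by (induction ts rule: list.induct) (auto split: prod.splits)

text \<open>Both sides are exhausted by counting: three edges for each block on \<open>n\<close>
  vertices, two for each kept or additional path on \<open>m\<close> vertices. For concrete lists
  every condition on them can be evaluated.\<close>

lemma linkable_lists:
  assumes \<phi>: "inj_on \<phi> {..<n}" and "m \<le> n"
    and ts: "list_all (p4_ok n m) ts" "distinct (concat (map p4_edges ts))"
      "3 * length ts = n choose 2"
    and us: "list_all (p3_ok m) us"
      "distinct (concat (map kept_edges ts) @ concat (map p3_edges us))"
      "2 * length ts + 2 * length us = m choose 2"
  shows "linkable (\<phi> ` set (concat (map inner ts)))
    (pairs_of (\<phi> ` {..<n})) (pairs_of (\<phi> ` {..<m}))"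
proof -
  let ?E = "concat (map p4_edges ts)" and ?F = "concat (map kept_edges ts)"
    and ?G = "concat (map p3_edges us)"
  note ok = p4_ok_edges[OF ts(1) \<open>m \<le> n\<close>] p3_ok_edges[OF us(1)]
  have \<phi>': "inj_on \<phi> {..<m}"
    using \<phi> by (rule inj_on_subset) (use \<open>m \<le> n\<close> in auto)
  have "linkable (\<phi> ` set (concat (map inner ts)) \<union> {}) (edge_image \<phi> ?E \<union> {})
    (edge_image \<phi> ?F \<union> edge_image \<phi> ?G)"
  proof (rule linkable_Un)
    show "linkable (\<phi> ` set (concat (map inner ts))) (edge_image \<phi> ?E) (edge_image \<phi> ?F)"
      by (rule linkable_p4_list) fact+
    show "linkable {} {} (edge_image \<phi> ?G)"
      using us \<phi>' by (intro linkable_p3_list) auto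
    show "edge_image \<phi> ?F \<inter> edge_image \<phi> ?G = {}"
      using us(2) \<phi>' ok by (intro edge_image_disjoint) auto
  qed simp
  moreover have "edge_image \<phi> ?E = pairs_of (\<phi> ` {..<n})"
    by (rule edge_image_complete) (use \<phi> ts ok in \<open>simp_all only: length_concat_p4_edges\<close>)
  moreover have "edge_image \<phi> (?F @ ?G) = pairs_of (\<phi> ` {..<m})"
    by (rule edge_image_complete)
      (use \<phi>' us ok in \<open>simp_all only: length_concat_kept_edges length_concat_p3_edges
        length_append set_append Un_subset_iff\<close>)
  ultimately show ?thesis
    by simp
qed

section \<open>The two uses of the lists: equal orders, and one vertex missing\<close>

lemma obtain_enumeration:
  assumes "finite V" "card V = n"
  obtains \<phi> :: "nat \<Rightarrow> 'a" where "inj_on \<phi> {..<n}" "\<phi> ` {..<n} = V"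
  using ex_bij_betw_nat_finite[OF assms(1)] assms(2)
  by (auto simp: bij_betw_def lessThan_atLeast0)

text \<open>The last hypothesis makes every vertex internal in some block, which
  \<open>linkable_inner\<close> requires of its pieces.\<close>

lemma linkable_complete_self:
  assumes "list_all (p4_ok n n) ts" "distinct (concat (map p4_edges ts))"
    "3 * length ts = n choose 2" "list_all (p3_ok n) us"
    "distinct (concat (map kept_edges ts) @ concat (map p3_edges us))"
    "2 * length ts + 2 * length us = n choose 2"
    and "finite V" "card V = n" "list_all (\<lambda>i. i \<in> set (concat (map inner ts))) [0..<n]"
  shows "linkable V (pairs_of V) (pairs_of V)"
proof -
  obtain \<phi> where \<phi>: "inj_on \<phi> {..<n}" "\<phi> ` {..<n} = V"
    using obtain_enumeration assms(7,8) by blast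
  have "linkable (\<phi> ` set (concat (map inner ts))) (pairs_of V) (pairs_of V)"
    using linkable_lists[OF \<phi>(1) order_refl assms(1-6)] \<phi>(2) by simp
  moreover have "V \<subseteq> \<phi> ` set (concat (map inner ts))"
    using assms(9) \<phi>(2) by (auto simp: list_all_iff)
  ultimately show ?thesis
    by (rule linkable_mono)
qed

lemma linkable_complete_star:
  assumes "list_all (p4_ok (Suc m) m) ts" "distinct (concat (map p4_edges ts))"
    "3 * length ts = Suc m choose 2" "list_all (p3_ok m) us"
    "distinct (concat (map kept_edges ts) @ concat (map p3_edges us))"
    "2 * length ts + 2 * length us = m choose 2"
    and "finite W" "card W = m" "x \<notin> W"
  shows "linkable {} (pairs_of (insert x W)) (pairs_of W)"
proof -
  obtain \<phi> where \<phi>: "inj_on \<phi> {..<m}" "\<phi> ` {..<m} = W"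
    using obtain_enumeration assms(7,8) by blast
  \<comment> \<open>The number \<open>m\<close> stands for the missing vertex \<open>x\<close>.
    Injectivity of \<open>\<psi>\<close> then follows because its image has as many elements as its
    domain.\<close>
  define \<psi> where "\<psi> = \<phi>(m := x)"
  have W: "\<psi> ` {..<m} = W"
    using \<phi>(2) by (auto simp: \<psi>_def)
  have V: "\<psi> ` {..<Suc m} = insert x W"
    using \<phi>(2) by (auto simp: \<psi>_def lessThan_Suc)
  have "card (insert x W) = card {..<Suc m}"
    using assms(7-9) by simp
  then have "inj_on \<psi> {..<Suc m}"
    by (intro eq_card_imp_inj_on) (simp_all only: V finite_lessThan)
  from linkable_lists[OF this _ assms(1-6)] have
    "linkable (\<psi> ` set (concat (map inner ts))) (pairs_of (insert x W)) (pairs_of W)"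
    by (simp only: V W)
  then show ?thesis
    by (rule linkable_mono) simp
qed

text \<open>The lost edges 01 and 13 are regrouped as the path 0-1-3. The second lists for
  \<open>K_9\<close> and \<open>K_12\<close> arise from the lost edges in the same way.\<close>

lemma linkable_K4:
  assumes "finite V" "card V = 4"
  shows "linkable V (pairs_of V) (pairs_of V)"
  by (rule linkable_complete_self[of 4
      "[(0,1,2,3), (1,3,0,2)]" "[(0,1,3)]"])
    (use assms in \<open>simp_all add: nedge_def choose_two upt_rec\<close>)

lemma linkable_K9:
  assumes "finite V" "card V = 9"
  shows "linkable V (pairs_of V) (pairs_of V)"
  by (rule linkable_complete_self[of 9
      "[(0,1,5,6), (3,5,2,8), (0,5,7,6), (5,8,6,4), (5,4,7,3), (7,2,0,6), (0,8,3,6), (6,2,1,3),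
      (6,1,7,0), (7,8,4,2), (2,3,0,4), (3,4,1,8)]"
      "[(1,0,5), (0,8,5), (1,6,2), (2,3,4), (2,7,8), (3,5,4)]"])
    (use assms in \<open>simp_all add: nedge_def choose_two upt_rec\<close>)

lemma linkable_K12:
  assumes "finite V" "card V = 12"
  shows "linkable V (pairs_of V) (pairs_of V)"
  by (rule linkable_complete_self[of 12
      "[(8,0,6,4), (3,9,0,4), (11,7,0,10), (0,3,1,2), (5,0,11,3), (8,6,1,0), (1,7,2,0),
      (4,11,1,8), (9,1,10,11), (6,9,4,1), (1,5,6,10), (7,6,3,5), (6,2,11,9), (6,11,5,8),
      (11,8,4,5), (7,4,10,5), (5,2,4,3), (8,9,5,7), (2,10,9,7), (10,8,2,9), (2,3,7,8),
      (7,10,3,8)]"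
      "[(3,0,5), (0,8,9), (1,5,2), (1,7,6), (1,9,3), (3,2,10), (2,6,11), (4,7,10), (4,11,7),
      (8,6,9), (10,8,11)]"])
    (use assms in \<open>simp_all add: nedge_def choose_two upt_rec\<close>)

text \<open>The blocks x, i, i+1, i+3 with i modulo 5 lose exactly the edges at \<open>x\<close>.
  They keep the differences 1 and 2, which make up all of \<open>K_5\<close>, so no further path is
  needed.\<close>

lemma linkable_K6_K5:
  assumes "finite W" "card W = 5" "x \<notin> W"
  shows "linkable {} (pairs_of (insert x W)) (pairs_of W)"
  by (rule linkable_complete_star[of 5
      "[(5,0,1,3), (5,1,2,4), (5,2,3,0), (5,3,4,1), (5,4,0,2)]"
      "[]"])
    (use assms in \<open>simp_all add: nedge_def choose_two upt_rec\<close>)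

text \<open>Again the blocks x, i, i+1, i+3, now modulo 8, lose the edges at \<open>x\<close> and
  keep the differences 1 and 2. Four more blocks use up the differences 3 and 4; their lost edges
  form the second list. The next two lemmas follow this pattern modulo 9 and 12.\<close>

lemma linkable_K9_K8:
  assumes "finite W" "card W = 8" "x \<notin> W"
  shows "linkable {} (pairs_of (insert x W)) (pairs_of W)"
  by (rule linkable_complete_star[of 8
      "[(8,0,1,3), (8,1,2,4), (8,2,3,5), (8,3,4,6), (8,4,5,7), (8,5,6,0), (8,6,7,1), (8,7,0,2),
      (3,6,1,4), (6,2,5,1), (7,3,0,5), (2,7,4,0)]"
      "[(6,2,7), (6,3,7)]"])
    (use assms in \<open>simp_all add: nedge_def choose_two upt_rec\<close>)

lemma linkable_K10_K9:
  assumes "finite W" "card W = 9" "x \<notin> W"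
  shows "linkable {} (pairs_of (insert x W)) (pairs_of W)"
  by (rule linkable_complete_star[of 9
      "[(9,0,1,3), (9,1,2,4), (9,2,3,5), (9,3,4,6), (9,4,5,7), (9,5,6,8), (9,6,7,0), (9,7,8,1),
      (9,8,0,2), (3,0,5,1), (6,0,4,7), (3,8,5,2), (4,8,2,6), (2,7,1,4), (7,3,6,1)]"
      "[(3,0,6), (2,7,3), (3,8,4)]"])
    (use assms in \<open>simp_all add: nedge_def choose_two upt_rec\<close>)

lemma linkable_K13_K12:
  assumes "finite W" "card W = 12" "x \<notin> W"
  shows "linkable {} (pairs_of (insert x W)) (pairs_of W)"
  by (rule linkable_complete_star[of 12
      "[(12,0,1,3), (12,1,2,4), (12,2,3,5), (12,3,4,6), (12,4,5,7), (12,5,6,8), (12,6,7,9),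
      (12,7,8,10), (12,8,9,11), (12,9,10,0), (12,10,11,1), (12,11,0,2), (2,9,5,1), (1,9,6,10),
      (7,4,0,9), (9,4,1,6), (1,8,3,9), (0,7,10,1), (3,11,7,1), (6,0,3,7), (7,2,8,5), (10,5,0,8),
      (2,6,11,8), (8,4,11,2), (10,2,5,11), (6,3,10,4)]"
      "[(6,0,7), (1,8,4), (1,9,4), (6,2,9), (2,7,4), (2,10,5), (6,3,11)]"])
    (use assms in \<open>simp_all add: nedge_def choose_two upt_rec\<close>)

text \<open>The blocks of this decomposition of \<open>K\<^sub>6\<close> have all six vertices as internal vertices; what
  they are linked to does not matter.\<close>

lemma linkable_K6:
  assumes "finite V" "card V = 6"
  obtains F where "F \<subseteq> pairs_of V" "linkable V (pairs_of V) F"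
proof -
  define ts :: "(nat \<times> nat \<times> nat \<times> nat) list"
    where "ts = [(3,4,2,0), (2,3,1,4), (4,0,3,5), (4,5,1,2), (2,5,0,1)]"
  obtain \<phi> where \<phi>: "inj_on \<phi> {..<6::nat}" "\<phi> ` {..<6} = V"
    using obtain_enumeration assms by blast
  have ok: "list_all (p4_ok 6 6) ts" "distinct (concat (map p4_edges ts))"
    by (simp_all add: ts_def nedge_def)
  have "length (concat (map p4_edges ts)) = 6 choose 2"
    by (simp add: ts_def choose_two)
  with edge_image_complete[OF \<phi>(1) p4_ok_edges(1)[OF ok(1) order_refl] ok(2)] \<phi>(2)
  have E: "edge_image \<phi> (concat (map p4_edges ts)) = pairs_of V"
    by simp
  have "{..<6} \<subseteq> set (concat (map inner ts))"
    by (auto simp: ts_def)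
  with \<phi>(2) have "V \<subseteq> \<phi> ` set (concat (map inner ts))"
    by blast
  then have "linkable V (pairs_of V) (edge_image \<phi> (concat (map kept_edges ts)))"
    using linkable_p4_list[OF \<phi>(1) order_refl ok] unfolding E by (metis linkable_mono)
  moreover have "edge_image \<phi> (concat (map kept_edges ts)) \<subseteq> pairs_of V"
    using edge_image_mono[OF kept_edges_subset] unfolding E[symmetric] .
  ultimately show thesis
    using that by blast
qed

section \<open>Linked decompositions of complete graphs\<close>

text \<open>Residue 1 starts at 13 = 4 + 9 because 7 - 6 is too small to be an order. The order 7
  does not come up later, where one less than the order is 0 or 1 modulo 4.\<close>

lemma order_cases_6:
  fixes n :: nat
  assumes "4 \<le> n" "n mod 6 \<in> {0, 3, 4} \<or> n mod 6 = 1 \<and> 13 \<le> n"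
  shows "n = 4 \<or> n = 6 \<or> n = 9 \<or> n = 4 + 9 \<or>
      n = 6 + (n - 6) \<and> 4 \<le> n - 6 \<and>
      ((n - 6) mod 6 \<in> {0, 3, 4} \<or> (n - 6) mod 6 = 1 \<and> 13 \<le> n - 6)"
proof (cases "6 \<le> n")
  case True
  define q r where "q = n div 6" "r = n mod 6"
  then have n: "n = 6 * q + r"
    by simp
  have "(n - 6) mod 6 = r"
    using True by (simp add: q_r_def le_mod_geq)
  then show ?thesis
    using assms True unfolding q_r_def(2)[symmetric] n by auto
next
  case False
  then have "n = 4 \<or> n = 5"
    using assms(1) by auto
  then show ?thesis
    using assms(2) by auto
qed

lemma order_cases_12:
  fixes n :: nat
  assumes "4 \<le> n" "n mod 12 \<in> {0, 1, 4, 9}"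
  shows "n = 4 \<or> n = 9 \<or> n = 12 \<or> n = 4 + 9 \<or>
      n = 12 + (n - 12) \<and> 4 \<le> n - 12 \<and> (n - 12) mod 12 \<in> {0, 1, 4, 9}"
proof (cases "12 \<le> n")
  case True
  define q r where "q = n div 12" "r = n mod 12"
  then have n: "n = 12 * q + r"
    by simp
  have "(n - 12) mod 12 = r"
    using True by (simp add: q_r_def le_mod_geq)
  then show ?thesis
    using assms True unfolding q_r_def(2)[symmetric] n by auto
qed (use assms in auto)

lemma order_cases_12_star:
  fixes n :: nat
  assumes "5 \<le> n" "n mod 12 \<in> {0, 5, 8, 9}"
  shows "n = 5 \<or> n = 8 \<or> n = 9 \<or> n = 12 \<or>
      n = 12 + (n - 12) \<and> 5 \<le> n - 12 \<and> (n - 12) mod 12 \<in> {0, 5, 8, 9}"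
proof (cases "12 \<le> n")
  case True
  define q r where "q = n div 12" "r = n mod 12"
  then have n: "n = 12 * q + r"
    by simp
  have "(n - 12) mod 12 = r"
    using True by (simp add: q_r_def le_mod_geq)
  then show ?thesis
    using assms True unfolding q_r_def(2)[symmetric] n by auto
qed (use assms in auto)

lemma linkable_pairs_of_Un:
  assumes "linkable A (pairs_of A) F" "F \<subseteq> pairs_of A"
    and "linkable B (pairs_of B) G" "G \<subseteq> pairs_of B"
    and "linkable {} (bip A B) (bip A B)" "A \<inter> B = {}"
  shows "linkable (A \<union> B) (pairs_of (A \<union> B)) (F \<union> (G \<union> bip A B))"
proof -
  have d: "pairs_of A \<inter> pairs_of B = {}" "pairs_of A \<inter> bip A B = {}" "pairs_of B \<inter> bip A B = {}"
    using pairs_of_disjoint[of A B] pairs_of_bip_disjoint[of B A B]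
      pairs_of_bip_disjoint[of A A B] pairs_of_bip_disjoint[of A B A]
      pairs_of_bip_disjoint[of B A] bip_commute[of A B] assms(6)
    by (auto simp: Int_commute)
  have "linkable (A \<union> (B \<union> {})) (pairs_of A \<union> (pairs_of B \<union> bip A B)) (F \<union> (G \<union> bip A B))"
    using assms d by (intro linkable_Un) blast+
  then show ?thesis
    using pairs_of_Un[OF assms(6)] by simp
qed

text \<open>Only the internal vertices matter here, so \<open>F\<close> is arbitrary and steps of 6
  suffice. The condition \<open>F \<subseteq> pairs_of V\<close> keeps the linked parts disjoint
  when pieces are glued.\<close>

lemma linkable_inner:
  assumes "finite V" "4 \<le> card V"
    and "card V mod 6 \<in> {0, 3, 4} \<or> card V mod 6 = 1 \<and> 13 \<le> card V"
  shows "\<exists>F. F \<subseteq> pairs_of V \<and> linkable V (pairs_of V) F"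
  using assms
proof (induction "card V" arbitrary: V rule: less_induct)
  case less
  have step: "\<exists>F. F \<subseteq> pairs_of V \<and> linkable V (pairs_of V) F"
    if "V = A \<union> B" "A \<inter> B = {}" "linkable {} (bip A B) (bip A B)"
      "\<exists>F. F \<subseteq> pairs_of A \<and> linkable A (pairs_of A) F"
      "\<exists>F. F \<subseteq> pairs_of B \<and> linkable B (pairs_of B) F" for A B
  proof -
    obtain F G where FG: "F \<subseteq> pairs_of A" "linkable A (pairs_of A) F"
      "G \<subseteq> pairs_of B" "linkable B (pairs_of B) G"
      using \<open>\<exists>F. F \<subseteq> pairs_of A \<and> linkable A (pairs_of A) F\<close>
        \<open>\<exists>F. F \<subseteq> pairs_of B \<and> linkable B (pairs_of B) F\<close> by blast
    have "F \<union> (G \<union> bip A B) \<subseteq> pairs_of V"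
      using FG pairs_of_Un[OF \<open>A \<inter> B = {}\<close>] \<open>V = A \<union> B\<close> by blast
    with linkable_pairs_of_Un[OF FG(2,1,4,3)] that show ?thesis
      by blast
  qed
  have "card V = 4 \<or> card V = 6 \<or> card V = 9 \<or> card V = 4 + 9 \<or>
      card V = 6 + (card V - 6) \<and> 4 \<le> card V - 6 \<and>
      ((card V - 6) mod 6 \<in> {0, 3, 4} \<or> (card V - 6) mod 6 = 1 \<and> 13 \<le> card V - 6)"
    using order_cases_6[OF less.prems(2,3)] .
  then consider "card V = 4" | "card V = 6" | "card V = 9" | "card V = 4 + 9"
    | "card V = 6 + (card V - 6)" "4 \<le> card V - 6"
      "(card V - 6) mod 6 \<in> {0, 3, 4} \<or> (card V - 6) mod 6 = 1 \<and> 13 \<le> card V - 6"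
    by blast
  then show ?case
  proof cases
    case 1
    with linkable_K4[OF less.prems(1)] show ?thesis by blast
  next
    case 2
    show ?thesis
      by (rule linkable_K6[OF less.prems(1) 2]) blast
  next
    case 3
    with linkable_K9[OF less.prems(1)] show ?thesis by blast
  next
    case 4
    then obtain A B where AB: "V = A \<union> B" "A \<inter> B = {}" "card A = 4" "card B = 9"
      "finite A" "finite B"
      using split_set_card less.prems(1) by metis
    show ?thesis
    proof (rule step[OF AB(1,2)])
      \<comment> \<open>4 is even and 9 is a multiple of 3.\<close>
      show "linkable {} (bip A B) (bip A B)"
        using AB by (intro linkable_bip[of _ 2 _ 3]) auto
      show "\<exists>F. F \<subseteq> pairs_of A \<and> linkable A (pairs_of A) F"
        using linkable_K4[OF AB(5,3)] by blast
      show "\<exists>F. F \<subseteq> pairs_of B \<and> linkable B (pairs_of B) F"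
        using linkable_K9[OF AB(6,4)] by blast
    qed
  next
    case 5
    then obtain A B where AB: "V = A \<union> B" "A \<inter> B = {}" "card A = 6" "card B = card V - 6"
      "finite A" "finite B"
      using split_set_card less.prems(1) by metis
    show ?thesis
    proof (rule step[OF AB(1,2)])
      show "linkable {} (bip A B) (bip A B)"
        using AB 5 by (intro linkable_bip_mult6) auto
      show "\<exists>F. F \<subseteq> pairs_of A \<and> linkable A (pairs_of A) F"
        by (rule linkable_K6[OF AB(5,3)]) blast
      show "\<exists>F. F \<subseteq> pairs_of B \<and> linkable B (pairs_of B) F"
        using AB 5 by (intro less.hyps) auto
    qed
  qed
qed

text \<open>Here the \<open>P_3\<close>-side must fill \<open>K_n\<close> as well. Steps of 12
  preserve the residues, and \<open>K_12\<close> is itself linked to the complete graph on its own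
  vertices.\<close>

lemma linkable_same_order:
  assumes "finite V" "4 \<le> card V" "card V mod 12 \<in> {0, 1, 4, 9}"
  shows "linkable V (pairs_of V) (pairs_of V)"
  using assms
proof (induction "card V" arbitrary: V rule: less_induct)
  case less
  have step: "linkable V (pairs_of V) (pairs_of V)"
    if "V = A \<union> B" "A \<inter> B = {}" "linkable {} (bip A B) (bip A B)"
      "linkable A (pairs_of A) (pairs_of A)" "linkable B (pairs_of B) (pairs_of B)" for A B
    using linkable_pairs_of_Un[OF that(4) order_refl that(5) order_refl that(3,2)]
      pairs_of_Un[OF that(2)] that(1) by simp
  have "card V = 4 \<or> card V = 9 \<or> card V = 12 \<or> card V = 4 + 9 \<or>
      card V = 12 + (card V - 12) \<and> 4 \<le> card V - 12 \<and> (card V - 12) mod 12 \<in> {0, 1, 4, 9}"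
    using order_cases_12[OF less.prems(2,3)] .
  then consider "card V = 4" | "card V = 9" | "card V = 12" | "card V = 4 + 9"
    | "card V = 12 + (card V - 12)" "4 \<le> card V - 12" "(card V - 12) mod 12 \<in> {0, 1, 4, 9}"
    by blast
  then show ?case
  proof cases
    case 1
    with linkable_K4[OF less.prems(1)] show ?thesis by blast
  next
    case 2
    with linkable_K9[OF less.prems(1)] show ?thesis by blast
  next
    case 3
    with linkable_K12[OF less.prems(1)] show ?thesis by blast
  next
    case 4
    then obtain A B where AB: "V = A \<union> B" "A \<inter> B = {}" "card A = 4" "card B = 9"
      "finite A" "finite B"
      using split_set_card less.prems(1) by metis
    show ?thesis
    proof (rule step[OF AB(1,2)])
      show "linkable {} (bip A B) (bip A B)"
        using AB by (intro linkable_bip[of _ 2 _ 3]) auto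
      show "linkable A (pairs_of A) (pairs_of A)"
        by (rule linkable_K4[OF AB(5,3)])
      show "linkable B (pairs_of B) (pairs_of B)"
        by (rule linkable_K9[OF AB(6,4)])
    qed
  next
    case 5
    then obtain A B where AB: "V = A \<union> B" "A \<inter> B = {}" "card A = 12" "card B = card V - 12"
      "finite A" "finite B"
      using split_set_card less.prems(1) by metis
    show ?thesis
    proof (rule step[OF AB(1,2)])
      show "linkable {} (bip A B) (bip A B)"
        using AB 5 by (intro linkable_bip_mult6) auto
      show "linkable A (pairs_of A) (pairs_of A)"
        by (rule linkable_K12[OF AB(5,3)])
      show "linkable B (pairs_of B) (pairs_of B)"
        using AB 5 by (intro less.hyps) auto
    qed
  qed
qed

lemma pairs_of_insert_Un:
  assumes "A \<inter> B = {}"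
  shows "pairs_of (insert x (A \<union> B)) = pairs_of (insert x A) \<union> (pairs_of (insert x B) \<union> bip A B)"
proof (intro equalityI subsetI)
  fix e assume "e \<in> pairs_of (insert x (A \<union> B))"
  then show "e \<in> pairs_of (insert x A) \<union> (pairs_of (insert x B) \<union> bip A B)"
    by (elim pairs_ofE) (auto simp: bip_def image_iff insert_commute)
next
  fix e assume "e \<in> pairs_of (insert x A) \<union> (pairs_of (insert x B) \<union> bip A B)"
  then show "e \<in> pairs_of (insert x (A \<union> B))"
    using assms pairs_of_mono[of "insert x A" "insert x (A \<union> B)"]
      pairs_of_mono[of "insert x B" "insert x (A \<union> B)"]
    by (auto simp: bip_def)
qed

text \<open>The missing vertex \<open>x\<close> is shared by both pieces: its edges are divided
  between the complete graphs on \<open>insert x A\<close> and \<open>insert x B\<close>, and the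
  bipartite graph between \<open>A\<close> and \<open>B\<close> avoids it.\<close>

lemma linkable_one_less:
  assumes "finite W" "5 \<le> card W" "card W mod 12 \<in> {0, 5, 8, 9}" "x \<notin> W"
  shows "linkable {} (pairs_of (insert x W)) (pairs_of W)"
  using assms
proof (induction "card W" arbitrary: W rule: less_induct)
  case less
  have "card W = 5 \<or> card W = 8 \<or> card W = 9 \<or> card W = 12 \<or>
      card W = 12 + (card W - 12) \<and> 5 \<le> card W - 12 \<and> (card W - 12) mod 12 \<in> {0, 5, 8, 9}"
    using order_cases_12_star[OF less.prems(2,3)] .
  then consider "card W = 5" | "card W = 8" | "card W = 9" | "card W = 12"
    | "card W = 12 + (card W - 12)" "5 \<le> card W - 12" "(card W - 12) mod 12 \<in> {0, 5, 8, 9}"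
    by blast
  then show ?case
  proof cases
    case 1
    with linkable_K6_K5[OF less.prems(1)] less.prems(4) show ?thesis by blast
  next
    case 2
    with linkable_K9_K8[OF less.prems(1)] less.prems(4) show ?thesis by blast
  next
    case 3
    with linkable_K10_K9[OF less.prems(1)] less.prems(4) show ?thesis by blast
  next
    case 4
    with linkable_K13_K12[OF less.prems(1)] less.prems(4) show ?thesis by blast
  next
    case 5
    then obtain A B where AB: "W = A \<union> B" "A \<inter> B = {}" "card A = 12" "card B = card W - 12"
      "finite A" "finite B"
      using split_set_card less.prems(1) by metis
    have x: "x \<notin> A" "x \<notin> B"
      using AB less.prems(4) by auto
    have "linkable ({} \<union> ({} \<union> {}))
      (pairs_of (insert x A) \<union> (pairs_of (insert x B) \<union> bip A B))
      (pairs_of A \<union> (pairs_of B \<union> bip A B))"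
    proof (intro linkable_Un)
      show "linkable {} (pairs_of (insert x A)) (pairs_of A)"
        by (rule linkable_K13_K12[OF AB(5,3) x(1)])
      show "linkable {} (pairs_of (insert x B)) (pairs_of B)"
        using AB 5 x by (intro less.hyps) auto
      show "linkable {} (bip A B) (bip A B)"
        using AB 5 by (intro linkable_bip_mult6) auto
      have "pairs_of (insert x A) \<inter> pairs_of (insert x B) = {}"
        using AB(2) by (intro pairs_of_disjoint[of _ _ x]) auto
      moreover have A: "pairs_of (insert x A) \<inter> bip A B = {}"
        using AB(2) x by (intro pairs_of_bip_disjoint) auto
      moreover have B: "pairs_of (insert x B) \<inter> bip A B = {}"
        unfolding bip_commute[of A] using AB(2) x by (intro pairs_of_bip_disjoint) auto
      ultimately show "pairs_of (insert x A) \<inter> (pairs_of (insert x B) \<union> bip A B) = {}"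
        "pairs_of (insert x B) \<inter> bip A B = {}"
        by blast+
      then show "pairs_of A \<inter> (pairs_of B \<union> bip A B) = {}" "pairs_of B \<inter> bip A B = {}"
        using pairs_of_mono[of A "insert x A"] pairs_of_mono[of B "insert x B"] by blast+
    qed
    then show ?thesis
      unfolding AB(1) pairs_of_Un[OF AB(2)] pairs_of_insert_Un[OF AB(2)] by simp
  qed
qed

section \<open>Larger orders\<close>

text \<open>Any two edges at \<open>x\<close> form a \<open>P_3\<close> with middle
  \<open>x\<close>, so an even number of them can be paired up.\<close>

lemma linkable_even_star:
  assumes "finite E" "even (card E)" "\<And>e. e \<in> E \<Longrightarrow> \<exists>y. y \<noteq> x \<and> e = {x, y}"
  shows "linkable {} {} E"
proof -
  obtain k where "card E = 2 * k"
    using assms(2) by (elim evenE)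
  then show ?thesis
    using assms(1,3)
  proof (induction k arbitrary: E)
    case 0
    then show ?case
      by (simp add: linkable_empty)
  next
    case (Suc k)
    then obtain D E' where E: "E = D \<union> E'" "D \<inter> E' = {}" "card D = 2" "card E' = 2 * k" "finite E'"
      by (metis mult_Suc_right split_set_card)
    then obtain e e' where D: "D = {e, e'}" "e \<noteq> e'"
      by (auto simp: card_2_iff)
    obtain y z where yz: "e = {x, y}" "y \<noteq> x" "e' = {x, z}" "z \<noteq> x"
      using Suc.prems(3) E(1) D by (metis Un_iff insert_iff)
    have "linkable {} {} D"
      using linkable_path3[of y x z] yz D by (auto simp: insert_commute)
    moreover have "linkable {} {} E'"
      using E Suc.prems by (intro Suc.IH) auto
    ultimately show ?case
      using linkable_Un[of "{}" "{}" D "{}" "{}" E'] E by simp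
  qed
qed

text \<open>Peel off the stars at the vertices \<open>a \<noteq> w\<close> one after the other; the edge \<open>wa\<close> is used to
  make the number of edges of the star even.\<close>

lemma linkable_universal_vertex:
  assumes "finite F" "even (card F)" "\<And>e. e \<in> F \<Longrightarrow> card e = 2"
    and "\<And>a b. {a, b} \<in> F \<Longrightarrow> a \<noteq> w \<Longrightarrow> b \<noteq> w \<Longrightarrow> {w, a} \<in> F"
  shows "linkable {} {} F"
  using assms
proof (induction "card {e \<in> F. w \<notin> e}" arbitrary: F rule: less_induct)
  case less
  show ?case
  proof (cases "{e \<in> F. w \<notin> e} = {}")
    case True
    have "\<exists>y. y \<noteq> w \<and> e = {w, y}" if "e \<in> F" for e
    proof -
      have "card e = 2" "w \<in> e"
        using less.prems(3) True that by auto
      then show ?thesis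
        by (auto simp: card_2_iff)
    qed
    with less.prems show ?thesis
      by (intro linkable_even_star)
  next
    case False
    then obtain e0 where e0: "e0 \<in> F" "w \<notin> e0"
      by blast
    then obtain a b where ab: "e0 = {a, b}" "a \<noteq> b"
      using less.prems(3) by (metis card_2_iff)
    define D where "D = {e \<in> F. a \<in> e \<and> w \<notin> e}"
    define S where "S = (if even (card D) then D else insert {w, a} D)"
    have aw: "a \<noteq> w" "b \<noteq> w"
      using e0 ab by auto
    have wa: "{w, a} \<in> F"
      using less.prems(4)[of a b] e0 ab aw by blast
    have "finite D" "{w, a} \<notin> D"
      using less.prems(1) by (auto simp: D_def)
    then have S: "even (card S)" "finite S" "S \<subseteq> F" "D \<subseteq> S" "S \<subseteq> insert {w, a} D"
      using wa by (auto simp: S_def D_def)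
    have "e0 \<in> S"
      using S(4) e0 ab by (auto simp: D_def)
    have star: "\<exists>y. y \<noteq> a \<and> e = {a, y}" if "e \<in> S" for e
    proof -
      have "card e = 2" "a \<in> e"
        using that S(3,5) less.prems(3) by (auto simp: D_def)
      then show ?thesis
        by (auto simp: card_2_iff)
    qed
    have "linkable {} {} S"
      using S star by (intro linkable_even_star)
    moreover have "linkable {} {} (F - S)"
    proof (rule less.hyps)
      have "{e \<in> F - S. w \<notin> e} \<subset> {e \<in> F. w \<notin> e}"
        using e0 \<open>e0 \<in> S\<close> by blast
      then show "card {e \<in> F - S. w \<notin> e} < card {e \<in> F. w \<notin> e}"
        using less.prems(1) by (intro psubset_card_mono) auto
      show "even (card (F - S))"
        using S less.prems(1,2) by (simp add: card_Diff_subset)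
      \<comment> \<open>No edge at \<open>a\<close> avoiding \<open>w\<close> is left, and the only
        edge at \<open>w\<close> that may have been removed is wa, so the other vertices keep their
        edges to \<open>w\<close>.\<close>
      show "{w, c} \<in> F - S" if "{c, d} \<in> F - S" "c \<noteq> w" "d \<noteq> w" for c d
      proof -
        have "{w, c} \<in> F"
          using less.prems(4) that by blast
        moreover have "c \<noteq> a"
          using that S(4) by (auto simp: D_def)
        then have "{w, c} \<notin> S"
          using S(5) aw by (auto simp: D_def doubleton_eq_iff)
        ultimately show ?thesis
          by blast
      qed
    qed (use less.prems in auto)
    ultimately have "linkable {} {} (S \<union> (F - S))"
      using linkable_Un[of "{}" "{}" S "{}" "{}" "F - S"] by simp
    then show ?thesis
      using S(3) by (simp add: Un_absorb1)
  qed
qed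

section \<open>Divisibility of the number of edges\<close>

lemma two_times_choose_two: "2 * (n choose 2) = n * (n - 1)"
proof -
  have "even (n * (n - 1))"
    by (cases n) auto
  then show ?thesis
    unfolding choose_two by simp
qed

lemma even_choose_two: "even (n choose 2) \<longleftrightarrow> n mod 4 = 0 \<or> n mod 4 = 1"
proof -
  define q where "q = n div 4"
  have n: "n = 4 * q + n mod 4"
    unfolding q_def by simp
  note two_times_choose_two[of n]
  moreover have "n mod 4 < 4"
    by simp
  then consider "n mod 4 = 0" | "n mod 4 = 1" | "n mod 4 = 2" | "n mod 4 = 3"
    by linarith
  \<comment> \<open>Each branch is half of \<open>n * (n - 1)\<close> for n = 4q + r, factored so
    that its parity is visible.\<close>
  then have "n * (n - 1) = 2 * (if n mod 4 = 0 then 2 * (q * (4 * q - 1))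
      else if n mod 4 = 1 then 2 * ((4 * q + 1) * q)
      else if n mod 4 = 2 then (2 * q + 1) * (4 * q + 1) else (4 * q + 3) * (2 * q + 1))"
    by cases (subst (1 2) n, simp add: algebra_simps)+
  ultimately have "n choose 2 = (if n mod 4 = 0 then 2 * (q * (4 * q - 1))
      else if n mod 4 = 1 then 2 * ((4 * q + 1) * q)
      else if n mod 4 = 2 then (2 * q + 1) * (4 * q + 1) else (4 * q + 3) * (2 * q + 1))"
    by simp
  then show ?thesis
    by auto
qed

lemma three_dvd_choose_two: "3 dvd (n choose 2) \<Longrightarrow> n mod 3 \<noteq> 2"
proof
  assume "3 dvd (n choose 2)" "n mod 3 = 2"
  with two_times_choose_two[of n] have "(n * (n - 1)) mod 3 = 0"
    by (metis dvd_mult mod_eq_0_iff_dvd)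
  moreover have "(n - 1) mod 3 = 1"
    using \<open>n mod 3 = 2\<close> mod_Suc[of "n - 1" 3] by (cases n) (auto split: if_splits)
  then have "(n * (n - 1)) mod 3 = (2 * 1) mod 3"
    using \<open>n mod 3 = 2\<close> by (metis mod_mult_eq)
  ultimately show False
    by simp
qed

text \<open>Choose a \<open>P_3\<close> in each block. A vertex \<open>w\<close> of \<open>W\<close>
  outside \<open>V\<close> lies on none of the chosen paths, so in the remaining graph it is
  adjacent to all other vertices; the remainder is even since each chosen path has two edges. Hence
  \<open>linkable_universal_vertex\<close> applies.\<close>

lemma linkable_larger_order:
  assumes "finite V" "decomposes is_path4 (pairs_of V) \<B>"
    and "finite W" "V \<subset> W" "even (card W choose 2)"
  shows "linkable {} (pairs_of V) (pairs_of W)"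
proof -
  obtain w where w: "w \<in> W" "w \<notin> V"
    using assms(4) by blast
  have "\<exists>G. is_path3 G \<and> subgraph G B" if "B \<in> \<B>" for B
  proof -
    have "is_path4 B"
      using assms(2) that by (auto simp: decomposes_def)
    then obtain a b c d where B: "distinct [a, b, c, d]" "B = path4 a b c d"
      unfolding is_path4_def by blast
    then have "is_path3 (path3 b c d)"
      unfolding is_path3_def by auto
    moreover have "subgraph (path3 b c d) B"
      using simple_graph_path3[OF calculation] simple_graph_path4[OF \<open>is_path4 B\<close>] B
      by (auto simp: subgraph_def path3_def path4_def)
    ultimately show ?thesis
      by blast
  qed
  then obtain f where f: "\<And>B. B \<in> \<B> \<Longrightarrow> is_path3 (f B)" "\<And>B. B \<in> \<B> \<Longrightarrow> subgraph (f B) B"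
    by metis
  define F where "F = (\<Union>B\<in>\<B>. edges (f B))"
  have sub: "edges (f B) \<subseteq> edges B" if "B \<in> \<B>" for B
    using f(2)[OF that] by (auto simp: subgraph_def)
  have "disjoint_family_on edges (f ` \<B>)"
    unfolding disjoint_family_on_def
  proof (intro ballI impI)
    fix G H assume "G \<in> f ` \<B>" "H \<in> f ` \<B>" "G \<noteq> H"
    then obtain B C where BC: "B \<in> \<B>" "C \<in> \<B>" "G = f B" "H = f C" "B \<noteq> C"
      by blast
    then have "edges B \<inter> edges C = {}"
      using assms(2) by (auto simp: decomposes_def disjoint_family_on_def)
    with sub BC show "edges G \<inter> edges H = {}"
      by blast
  qed
  then have F: "decomposes is_path3 F (f ` \<B>)"
    using f(1) by (auto simp: decomposes_def F_def)
  have "F \<subseteq> pairs_of V"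
    using sub assms(2) unfolding F_def decomposes_def by blast
  moreover have "pairs_of V \<subseteq> pairs_of W"
    using assms(4) by (intro pairs_of_mono) auto
  ultimately have FW: "F \<subseteq> pairs_of W" "finite F"
    using finite_pairs_of[OF assms(1)] by (auto intro: finite_subset)
  have "linkable {} (pairs_of V) F"
    unfolding linkable_def down_link_def using assms(2) F f(2)
    by (intro exI[of _ \<B>] exI[of _ "f ` \<B>"] exI[of _ f]) auto
  moreover have "linkable {} {} (pairs_of W - F)"
  proof (rule linkable_universal_vertex)
    show "finite (pairs_of W - F)"
      using finite_pairs_of[OF assms(3)] by simp
    have "even (card F)"
      using card_decomposes[OF FW(2) F card_edges_path3] by simp
    then show "even (card (pairs_of W - F))"
      using FW assms(5) by (simp add: card_Diff_subset card_pairs_of assms(3))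
    show "card e = 2" if "e \<in> pairs_of W - F" for e
      using that by (simp add: pairs_of_def)
    show "{w, a} \<in> pairs_of W - F" if "{a, b} \<in> pairs_of W - F" "a \<noteq> w" "b \<noteq> w" for a b
    proof -
      have "{w, a} \<notin> F"
        using \<open>F \<subseteq> pairs_of V\<close> w(2) by auto
      then show ?thesis
        using that w by auto
    qed
  qed
  ultimately have "linkable ({} \<union> {}) (pairs_of V \<union> {}) (F \<union> (pairs_of W - F))"
    by (intro linkable_Un) auto
  then show ?thesis
    using FW(1) by (simp add: Un_absorb1)
qed

section \<open>Necessary conditions\<close>

text \<open>The image of the block through xy cannot contain xy, so it consists of the other two
  edges; one of these meets xy in the path.\<close>

lemma missing_vertex_unique:
  assumes "decomposes is_path4 (pairs_of V) \<B>" "decomposes is_path3 (pairs_of W) \<C>"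
    and "down_link f \<B> \<C>" "x \<in> V - W" "y \<in> V - W"
  shows "x = y"
proof (rule ccontr)
  assume "x \<noteq> y"
  then have "{x, y} \<in> pairs_of V"
    using assms by simp
  then obtain B where B: "B \<in> \<B>" "{x, y} \<in> edges B"
    using assms(1) unfolding decomposes_def by blast
  then obtain a b c d where abcd: "distinct [a, b, c, d]" "B = path4 a b c d"
    using assms(1) unfolding decomposes_def is_path4_def by blast
  obtain p q r where pqr: "f B = path3 p q r" "distinct [p, q, r]"
    "edges (f B) \<subseteq> pairs_of W" "edges (f B) \<subseteq> edges B"
    using down_linkE[OF assms(3,2) B(1)] .
  then have "p \<in> W" "q \<in> W" "r \<in> W" "{p, q} \<in> edges B" "{q, r} \<in> edges B"
    by (auto simp: path3_def)
  with assms(4,5) B(2) abcd pqr(2) show False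
    by (auto simp: path4_def doubleton_eq_iff)
qed

text \<open>Two of the three edges of the block contain an internal vertex, and its image keeps two
  edges, hence one of those.\<close>

lemma inner_not_missing:
  assumes "decomposes is_path3 (pairs_of W) \<C>" "down_link f \<B> \<C>"
    and "path4 a y c d \<in> \<B>" "distinct [a, y, c, d]"
  shows "y \<in> W"
proof -
  obtain p q r where pqr: "f (path4 a y c d) = path3 p q r" "distinct [p, q, r]"
    "edges (f (path4 a y c d)) \<subseteq> pairs_of W"
    "edges (f (path4 a y c d)) \<subseteq> edges (path4 a y c d)"
    using down_linkE[OF assms(2,1,3)] .
  then have "p \<in> W" "q \<in> W" "r \<in> W" "{p, q} \<in> edges (path4 a y c d)"
    "{q, r} \<in> edges (path4 a y c d)"
    by (auto simp: path3_def)
  with pqr(2) assms(4) show ?thesis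
    by (auto simp: path4_def doubleton_eq_iff)
qed

section \<open>Designs of a given order and the possible residues\<close>

lemma design_of_order_path4_iff:
  "design_of_order (path_graph 4) n \<B> \<longleftrightarrow>
     (\<exists>V. finite V \<and> card V = n \<and> decomposes is_path4 (pairs_of V) \<B>)"
  unfolding design_of_order_def using design_path4_iff by blast

lemma design_of_order_path3_iff:
  "design_of_order (path_graph 3) n \<B> \<longleftrightarrow>
     (\<exists>V. finite V \<and> card V = n \<and> decomposes is_path3 (pairs_of V) \<B>)"
  unfolding design_of_order_def using design_path3_iff by blast

text \<open>Chinese remaindering of the parity condition on the order of the
  \<open>P_3\<close>-design with the divisibility by 3 on the order of the
  \<open>P_4\<close>-design. The first part serves n = v, the second n = v - 1.\<close>

lemma mod_12_cases:
  fixes n :: nat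
  assumes "n mod 4 = 0 \<or> n mod 4 = 1"
  shows "n mod 3 \<noteq> 2 \<Longrightarrow> n mod 12 \<in> {0, 1, 4, 9}"
    and "Suc n mod 3 \<noteq> 2 \<Longrightarrow> n mod 12 \<in> {0, 5, 8, 9}"
proof -
  define r where "r = n mod 12"
  have r: "r mod 4 = n mod 4" "r mod 3 = n mod 3" "Suc r mod 3 = Suc n mod 3"
    unfolding r_def by (simp_all add: mod_mod_cancel mod_Suc)
  have "r < 12"
    unfolding r_def by simp
  then have "r = 0 \<or> r = 1 \<or> r = 2 \<or> r = 3 \<or> r = 4 \<or> r = 5 \<or> r = 6 \<or> r = 7 \<or> r = 8 \<or> r = 9 \<or>
      r = 10 \<or> r = 11"
    by presburger
  then show "n mod 3 \<noteq> 2 \<Longrightarrow> n mod 12 \<in> {0, 1, 4, 9}"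
    and "Suc n mod 3 \<noteq> 2 \<Longrightarrow> n mod 12 \<in> {0, 5, 8, 9}"
    using assms unfolding r_def[symmetric] r[symmetric] by auto
qed

text \<open>The residue of \<open>n\<close> modulo 12 is 0, 5, 8 or 9, which excludes 3 and 4. So
  \<open>Suc n\<close> is 1, 6, 9 or 10 modulo 12, and residue 1 forces it to be at least
  13.\<close>

lemma order_P4_Suc:
  fixes n :: nat
  assumes "Suc n mod 3 \<noteq> 2" "4 \<le> Suc n" "n mod 4 = 0 \<or> n mod 4 = 1"
  shows "5 \<le> n" "Suc n mod 6 \<in> {0, 3, 4} \<or> Suc n mod 6 = 1 \<and> 13 \<le> Suc n"
proof -
  have n: "n mod 12 \<in> {0, 5, 8, 9}"
    using mod_12_cases(2)[OF assms(3,1)] .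
  then show "5 \<le> n"
    using assms(2) by (cases "n < 5") auto
  have "Suc n mod 6 = Suc (n mod 12) mod 6"
    by (simp add: mod_Suc mod_mod_cancel)
  moreover have "n = 12 * (n div 12) + n mod 12"
    by simp
  ultimately show "Suc n mod 6 \<in> {0, 3, 4} \<or> Suc n mod 6 = 1 \<and> 13 \<le> Suc n"
    using n assms(2) by auto
qed

text \<open>Since \<open>1 < v\<close> there is an edge, hence a block, which needs four vertices;
  the residue comes from counting edges in threes.\<close>

lemma order_P4_design:
  assumes "1 < v" "design_of_order (path_graph 4) v \<B>"
  shows "4 \<le> v" "v mod 3 \<noteq> 2"
proof -
  obtain V where V: "finite V" "card V = v" "decomposes is_path4 (pairs_of V) \<B>"
    using assms(2) unfolding design_of_order_path4_iff by blast
  have "card (pairs_of V) = 3 * card \<B>"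
    using card_decomposes[OF finite_pairs_of[OF V(1)] V(3) card_edges_path4] by simp
  then show "v mod 3 \<noteq> 2"
    using V by (intro three_dvd_choose_two) (simp add: card_pairs_of)
  have "card (pairs_of V) \<noteq> 0"
    using assms(1) V by (simp add: card_pairs_of)
  then obtain e where "e \<in> pairs_of V"
    by fastforce
  then obtain B where B: "B \<in> \<B>" "is_path4 B" "edges B \<subseteq> pairs_of V"
    using V(3) unfolding decomposes_def by blast
  then obtain a b c d where abcd: "distinct [a, b, c, d]" "B = path4 a b c d"
    unfolding is_path4_def by blast
  with B(3) have "{a, b, c, d} \<subseteq> V"
    by (auto simp: path4_def)
  from card_mono[OF V(1) this] abcd(1) V(2) show "4 \<le> v"
    by simp
qed

section \<open>The two spectra\<close>

lemma linkable_imp_L1: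
  fixes V W :: "nat set"
  assumes "linkable C (pairs_of V) (pairs_of W)" "finite V" "finite W"
  shows "card W \<in> \<L>1 (path_graph 4) (card V)"
  using assms unfolding \<L>1_def design_of_order_path3_iff design_of_order_path4_iff linkable_def
  by blast

lemma L1_P4_necessary:
  assumes "n \<in> \<L>1 (path_graph 4) v"
  shows "v - 1 \<le> n" "n mod 4 = 0 \<or> n mod 4 = 1"
proof -
  obtain \<B> :: "nat sgraph set" and \<C> f V W where
    V: "finite V" "card V = v" "decomposes is_path4 (pairs_of V) \<B>" and
    W: "finite W" "card W = n" "decomposes is_path3 (pairs_of W) \<C>" and
    f: "down_link f \<B> \<C>"
    using assms unfolding \<L>1_def design_of_order_path3_iff design_of_order_path4_iff by blast
  have "card (pairs_of W) = 2 * card \<C>"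
    using card_decomposes[OF finite_pairs_of[OF W(1)] W(3) card_edges_path3] by simp
  then have "even (n choose 2)"
    using W by (simp add: card_pairs_of)
  then show "n mod 4 = 0 \<or> n mod 4 = 1"
    by (simp add: even_choose_two)
  have "card (V - W) \<le> 1"
    using missing_vertex_unique[OF V(3) W(3) f] V(1) by (simp add: card_le_Suc0_iff_eq)
  moreover have "card V - card W \<le> card (V - W)"
    using diff_card_le_card_Diff[OF W(1)] .
  ultimately show "v - 1 \<le> n"
    using V W by linarith
qed

lemma L1_P4_sufficient:
  assumes "1 < v" "design_of_order (path_graph 4) v (\<B> :: nat sgraph set)"
    and "v - 1 \<le> n" "n mod 4 = 0 \<or> n mod 4 = 1"
  shows "n \<in> \<L>1 (path_graph 4) v"
proof -
  note v = order_P4_design[OF assms(1,2)]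
  consider "n = v - 1" | "n = v" | "v < n"
    using assms(3) by linarith
  then show ?thesis
  proof cases
    case 1
    then have n: "v = Suc n"
      using assms(1) by simp
    have "5 \<le> n" "n mod 12 \<in> {0, 5, 8, 9}"
      using order_P4_Suc(1)[of n] mod_12_cases(2)[OF assms(4)] v assms(4) unfolding n by blast+
    \<comment> \<open>The \<open>P_4\<close>-design lives on the numbers up to \<open>n\<close>, and
      \<open>n\<close> itself is the missing vertex.\<close>
    then have "linkable {} (pairs_of (insert n {..<n})) (pairs_of {..<n})"
      by (intro linkable_one_less) auto
    from linkable_imp_L1[OF this] show ?thesis
      using 1 assms(1) by simp
  next
    case 2
    then have "4 \<le> n" "n mod 12 \<in> {0, 1, 4, 9}"
      using v mod_12_cases(1)[OF assms(4)] by simp_all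
    then have "linkable {..<n} (pairs_of {..<n}) (pairs_of {..<n})"
      by (intro linkable_same_order) auto
    from linkable_imp_L1[OF this] show ?thesis
      using 2 by simp
  next
    case 3
    obtain V where V: "finite V" "card V = v" "decomposes is_path4 (pairs_of V) \<B>"
      using assms(2) unfolding design_of_order_path4_iff by blast
    \<comment> \<open>The given design stays on \<open>V\<close>; fresh numbers outside
      \<open>V\<close> enlarge the vertex set to \<open>n\<close> elements.\<close>
    have "infinite (UNIV - V)"
      using V(1) by simp
    then obtain U where U: "finite U" "card U = n - v" "U \<subseteq> UNIV - V"
      using infinite_arbitrarily_large by blast
    have card: "card (V \<union> U) = n"
      using U V 3 by (subst card_Un_disjoint) auto
    then have "V \<subset> V \<union> U"
      using V 3 by auto
    moreover have "even (card (V \<union> U) choose 2)"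
      using assms(4) card by (simp add: even_choose_two)
    ultimately have "linkable {} (pairs_of V) (pairs_of (V \<union> U))"
      using U V by (intro linkable_larger_order[OF V(1,3)]) auto
    from linkable_imp_L1[OF this] show ?thesis
      using U V card by simp
  qed
qed

lemma L2_P4_necessary:
  assumes "1 < v" "design_of_order (path_graph 4) v (\<B>0 :: nat sgraph set)"
    and "n \<in> \<L>2 (path_graph 4) v"
  shows "n \<in> \<L>1 (path_graph 4) v" "v \<le> n"
proof -
  show n: "n \<in> \<L>1 (path_graph 4) v"
    \<comment> \<open>\<open>\<L>2\<close> quantifies over all designs; \<open>\<B>0\<close>
      supplies one to instantiate it with.\<close>
    using assms(2,3) unfolding \<L>1_def \<L>2_def by blast
  show "v \<le> n"
  proof (rule ccontr)
    assume "\<not> v \<le> n"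
    then have v: "v = Suc n"
      using L1_P4_necessary(1)[OF n] by simp
    have "v mod 6 \<in> {0, 3, 4} \<or> v mod 6 = 1 \<and> 13 \<le> v"
      using order_P4_design[OF assms(1,2)] L1_P4_necessary(2)[OF n] unfolding v
      by (intro order_P4_Suc(2))
    \<comment> \<open>A design with every vertex internal admits no missing vertex, so its down-link
      to an order below \<open>v\<close> is impossible.\<close>
    then obtain F where "linkable {..<v} (pairs_of {..<v}) F"
      using linkable_inner[of "{..<v}"] order_P4_design(1)[OF assms(1,2)] by auto
    then obtain \<B> where \<B>: "decomposes is_path4 (pairs_of {..<v}) \<B>"
      "\<forall>y\<in>{..<v}. \<exists>a c d. distinct [a, y, c, d] \<and> path4 a y c d \<in> \<B>"
      unfolding linkable_def by blast
    then have "design_of_order (path_graph 4) v \<B>"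
      unfolding design_of_order_path4_iff using finite_lessThan card_lessThan by blast
    then obtain \<C> f W where W: "finite W" "card W = n" "decomposes is_path3 (pairs_of W) \<C>"
      "down_link f \<B> \<C>"
      using assms(3) unfolding \<L>2_def design_of_order_path3_iff by blast
    have "{..<v} \<subseteq> W"
      using \<B>(2) inner_not_missing[OF W(3,4)] by blast
    from card_mono[OF W(1) this] W(2) \<open>\<not> v \<le> n\<close> show False
      by simp
  qed
qed

theorem theorem8p1:
  fixes v :: nat
  assumes "v > 1"
    and "\<exists>\<B> :: nat sgraph set. design_of_order (path_graph 4) v \<B>"
  shows "\<L>1 (path_graph 4) v = {n. n \<ge> v - 1 \<and> (n mod 4 = 0 \<or> n mod 4 = 1)} \<and>
         \<L>2 (path_graph 4) v \<subseteq> {n. n \<ge> v \<and> (n mod 4 = 0 \<or> n mod 4 = 1)}"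
proof -
  obtain \<B> :: "nat sgraph set" where \<B>: "design_of_order (path_graph 4) v \<B>"
    using assms(2) by blast
  have "\<L>1 (path_graph 4) v = {n. n \<ge> v - 1 \<and> (n mod 4 = 0 \<or> n mod 4 = 1)}"
    using L1_P4_necessary[of _ v] L1_P4_sufficient[OF assms(1) \<B>]
    by (intro equalityI subsetI CollectI conjI) (simp_all only: mem_Collect_eq)
  moreover have "\<L>2 (path_graph 4) v \<subseteq> {n. n \<ge> v \<and> (n mod 4 = 0 \<or> n mod 4 = 1)}"
    using L2_P4_necessary[OF assms(1) \<B>] L1_P4_necessary(2)[of _ v]
    by blast
  ultimately show ?thesis
    by blast
qed

end
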